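(* Let $\theta\in(0,2)$ and let $C_\theta>0$ be a constant, depending only on $\theta$, such that $|E_{\theta,\theta+1}(-z)|\le C_\theta/(1+z)$ and $|E_{\theta}(-z)|\le C_\theta/(1+z)$ for all $z\in\mathbb{R}_+$. Then the family $$g_\alpha(\lambda):=g^\theta(\alpha^{-1/\theta},\lambda)=\alpha^{-1}E_{\theta,\theta+1}(-\lambda\alpha^{-1}),\qquad 0<\lambda\le\|A\|^2,$$ is a generator function for a linear regularization method for $Ax=y$ (in the sense of the definition in the context), where condition (iii) of that definition holds with $\gamma_*=C_\theta/2$. Consequently, FAR with fractional order $\theta$ is a linear regularization method for the ill-posed linear operator equation $Ax=y$.
   Context: $A:\mathcal{X}\to\mathcal{Y}$ is a compact linear operator between infinite-dimensional Hilbert spaces with infinite-dimensional range, $A^*$ is its adjoint, and $Ax=y$ is the (ill-posed) operator equation. Noisy data $y^\delta\in\mathcal{Y}$ satisfy $\|y^\delta-y\|\le\delta$. Mittag-Leffler functions: $E_{\theta_1,\theta_2}(z)=\sum_{k=0}^\infty \frac{z^k}{\Gamma(\theta_1k+\theta_2)}$ and $E_\theta(z)=E_{\theta,1}(z)$. FAR (fractional asymptotical regularization) of order $\theta\in(0,2)$: $x^\delta(t)$ is the solution of $({}^CD^\theta_{0+}x^\delta)(t)+A^*Ax^\delta(t)=A^*y^\delta$, $t>0$, with vanishing initial data ($x^\delta(0)=0$, and also $\dot x^\delta(0)=0$ if $\theta>1$), where ${}^CD^\theta_{0+}$ is the left-sided Caputo derivative of order $\theta$ (the ordinary first derivative if $\theta=1$).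 It is given by $x^\delta(t)=g^\theta(t,A^*A)A^*y^\delta$ with $g^\theta(t,\lambda):=t^\theta E_{\theta,\theta+1}(-\lambda t^\theta)$. The time $t>0$ corresponds to the regularization parameter $\alpha>0$ via $t=\alpha^{-1/\theta}$, so $x^\delta(t)=g_{t^{-\theta}}(A^*A)A^*y^\delta$. Definition (generator function). A family of functions $g_\alpha(\lambda)$, $0<\lambda\le\|A\|^2$, defined for regularization parameters $0<\alpha\le\bar\alpha$, is called a generator function for a linear regularization method for $Ax=y$ (the method being $x_\alpha^\delta=g_\alpha(A^*A)A^*y^\delta$) if: (i) for the bias function $r_\alpha(\lambda)=1-\lambda g_\alpha(\lambda)$ and any fixed $\lambda\in(0,\|A\|^2]$, $\lim_{\alpha\to0}|r_\alpha(\lambda)|=0$; (ii) there is a constant $\gamma_1>0$ with $|r_\alpha(\lambda)|\le\gamma_1$ for all $\lambda\in(0,\|A\|^2]$ and $\alpha\in(0,\bar\alpha]$; (iii) there is a constant $\gamma_*>0$ with $\sqrt{\lambda}\,|g_\alpha(\lambda)|\le\gamma_*/\sqrt{\alpha}$ for all $\lambda\in(0,\|A\|^2]$ and $\alpha\in(0,\bar\alpha]$. *)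

theory Defs
  imports "HOL-Analysis.Analysis"
begin

text \<open>
  Hilbert spaces are types of sort \<open>{real_inner,banach}\<close>. A complex Hilbert space
  is covered through the real inner product \<open>Re (x \<bullet> y)\<close>, which has the same norm and gives
  the same adjoint of a complex-linear operator.
\<close>

definition infinite_dimensional :: "'a::real_vector set \<Rightarrow> bool" where
  "infinite_dimensional V \<longleftrightarrow> \<not> (\<exists>B. finite B \<and> V \<subseteq> span B)"

definition compact_operator :: "('a::real_normed_vector \<Rightarrow> 'b::real_normed_vector) \<Rightarrow> bool" where
  "compact_operator A \<longleftrightarrow>
     bounded_linear A \<and> (\<forall>S. bounded S \<longrightarrow> compact (closure (A ` S)))"


subsection \<open>Functions of a compact self-adjoint operator\<close>

definition eigenspace :: "('a::real_vector \<Rightarrow> 'a) \<Rightarrow> real \<Rightarrow> 'a set" where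
  "eigenspace T \<mu> = {x. T x = \<mu> *\<^sub>R x}"

definition eigenvalues :: "('a::real_vector \<Rightarrow> 'a) \<Rightarrow> real set" where
  "eigenvalues T = {\<mu>. \<exists>x. x \<noteq> 0 \<and> T x = \<mu> *\<^sub>R x}"

definition orthogonal_projection :: "'a::real_inner set \<Rightarrow> 'a \<Rightarrow> 'a" where
  "orthogonal_projection V x = (THE p. p \<in> V \<and> (\<forall>v\<in>V. (x - p) \<bullet> v = 0))"

text \<open>
  For a compact self-adjoint operator \<open>T\<close> the spectral resolution is the orthogonal sum over
  the (countably many) eigenvalues \<open>\<mu>\<close> of the projections \<open>P\<^sub>\<mu>\<close> onto the eigenspaces, and
  \<open>f(T) x\<close> is the sum of \<open>f(\<mu>) P\<^sub>\<mu> x\<close>. The sum converges unconditionally whenever \<open>f\<close> is bounded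
  on the eigenvalues.
\<close>

definition operator_function :: "('a::real_inner \<Rightarrow> 'a) \<Rightarrow> (real \<Rightarrow> real) \<Rightarrow> 'a \<Rightarrow> 'a" where
  "operator_function T f x =
     (\<Sum>\<^sub>\<infinity>\<mu>\<in>eigenvalues T. f \<mu> *\<^sub>R orthogonal_projection (eigenspace T \<mu>) x)"


subsection \<open>Linear regularization methods and their generator functions\<close>

definition bias :: "(real \<Rightarrow> real \<Rightarrow> real) \<Rightarrow> real \<Rightarrow> real \<Rightarrow> real" where
  "bias g \<alpha> \<mu> = 1 - \<mu> * g \<alpha> \<mu>"

definition generator_bound ::
    "('a::real_inner \<Rightarrow> 'b::real_inner) \<Rightarrow> real \<Rightarrow> (real \<Rightarrow> real \<Rightarrow> real) \<Rightarrow> real \<Rightarrow> bool" where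
  "generator_bound A \<alpha>bar g \<gamma> \<longleftrightarrow>
     (\<forall>\<mu>\<in>{0<..(onorm A)\<^sup>2}. \<forall>\<alpha>\<in>{0<..\<alpha>bar}. sqrt \<mu> * \<bar>g \<alpha> \<mu>\<bar> \<le> \<gamma> / sqrt \<alpha>)"

definition generator_function ::
    "('a::real_inner \<Rightarrow> 'b::real_inner) \<Rightarrow> real \<Rightarrow> (real \<Rightarrow> real \<Rightarrow> real) \<Rightarrow> bool" where
  "generator_function A \<alpha>bar g \<longleftrightarrow>
     (\<forall>\<mu>\<in>{0<..(onorm A)\<^sup>2}. ((\<lambda>\<alpha>. \<bar>bias g \<alpha> \<mu>\<bar>) \<longlongrightarrow> 0) (at_right 0)) \<and>
     (\<exists>\<gamma>\<^sub>1>0. \<forall>\<mu>\<in>{0<..(onorm A)\<^sup>2}. \<forall>\<alpha>\<in>{0<..\<alpha>bar}. \<bar>bias g \<alpha> \<mu>\<bar> \<le> \<gamma>\<^sub>1) \<and>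
     (\<exists>\<gamma>>0. generator_bound A \<alpha>bar g \<gamma>)"

text \<open>
  The family \<open>R\<close> of reconstruction maps, \<open>R \<alpha> y\<close> being the approximate solution for the (noisy)
  data \<open>y\<close>, is the linear regularization method \<open>g\<^sub>\<alpha>(A\<^sup>*A)A\<^sup>*\<close> generated by \<open>g\<close>. The value
  \<open>g \<alpha> 0\<close>, for which nothing is assumed, does not matter, as \<open>A\<^sup>*y\<close> is orthogonal to the kernel
  of \<open>A\<^sup>*A\<close>.
\<close>

definition linear_regularization_method ::
    "('a::real_inner \<Rightarrow> 'b::real_inner) \<Rightarrow> real \<Rightarrow> (real \<Rightarrow> real \<Rightarrow> real) \<Rightarrow>
     (real \<Rightarrow> 'b \<Rightarrow> 'a) \<Rightarrow> bool" where
  "linear_regularization_method A \<alpha>bar g R \<longleftrightarrow>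
     generator_function A \<alpha>bar g \<and>
     (\<forall>\<alpha>\<in>{0<..\<alpha>bar}. \<forall>y. R \<alpha> y = operator_function (adjoint A \<circ> A) (g \<alpha>) (adjoint A y))"


subsection \<open>Fractional asymptotical regularization\<close>

definition mittag_leffler :: "real \<Rightarrow> real \<Rightarrow> real \<Rightarrow> real" where
  "mittag_leffler \<theta>\<^sub>1 \<theta>\<^sub>2 z = (\<Sum>k. z ^ k / Gamma (\<theta>\<^sub>1 * real k + \<theta>\<^sub>2))"

definition far_time_generator :: "real \<Rightarrow> real \<Rightarrow> real \<Rightarrow> real" where
  "far_time_generator \<theta> t \<mu> = t powr \<theta> * mittag_leffler \<theta> (\<theta> + 1) (- \<mu> * t powr \<theta>)"

definition far_generator :: "real \<Rightarrow> real \<Rightarrow> real \<Rightarrow> real" where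
  "far_generator \<theta> \<alpha> \<mu> = far_time_generator \<theta> (\<alpha> powr (- 1 / \<theta>)) \<mu>"

definition iterated_derivative :: "nat \<Rightarrow> (real \<Rightarrow> 'a::real_normed_vector) \<Rightarrow> real \<Rightarrow> 'a" where
  "iterated_derivative n x = ((\<lambda>f t. vector_derivative f (at t)) ^^ n) x"

text \<open>
  With \<open>n = \<lceil>\<theta>\<rceil>\<close>, the left-sided Caputo derivative is
  \<open>1/\<Gamma>(n - \<theta>) \<integral>\<^sub>0\<^sup>t (t - s)\<^bsup>n - \<theta> - 1\<^esup> x\<^bsup>(n)\<^esup>(s) ds\<close>, and the ordinary \<open>n\<close>-th derivative if
  \<open>\<theta> = n\<close>. The predicate \<open>caputo_differentiable\<close> collects what is needed for this to make sense
  for all \<open>t > 0\<close>: \<open>x\<^bsup>(n)\<^esup>\<close> exists on \<open>(0, \<infinity>)\<close>, is absolutely integrable up to \<open>0\<close> (where it is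
  singular for the functions of interest), and the integral exists.
\<close>

definition caputo_derivative :: "real \<Rightarrow> (real \<Rightarrow> 'a::banach) \<Rightarrow> real \<Rightarrow> 'a" where
  "caputo_derivative \<theta> x t =
     (let n = nat \<lceil>\<theta>\<rceil> in
      if \<theta> = real n then iterated_derivative n x t
      else (1 / Gamma (real n - \<theta>)) *\<^sub>R
        integral {0..t} (\<lambda>s. (t - s) powr (real n - \<theta> - 1) *\<^sub>R iterated_derivative n x s))"

definition caputo_differentiable :: "real \<Rightarrow> (real \<Rightarrow> 'a::banach) \<Rightarrow> bool" where
  "caputo_differentiable \<theta> x \<longleftrightarrow>
     (let n = nat \<lceil>\<theta>\<rceil> in
      (\<forall>k<n. \<forall>t>0. iterated_derivative k x differentiable (at t)) \<and>
      (\<forall>t>0. (\<lambda>s. norm (iterated_derivative n x s)) integrable_on {0..t}) \<and>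
      (\<theta> \<noteq> real n \<longrightarrow>
        (\<forall>t>0. (\<lambda>s. (t - s) powr (real n - \<theta> - 1) *\<^sub>R iterated_derivative n x s)
                 integrable_on {0..t})))"

text \<open>
  \<open>x\<close> solves the evolution equation of fractional asymptotical regularization of order \<open>\<theta>\<close>
  for the data \<open>y\<close>. Only the values of \<open>x\<close> on \<open>[0, \<infinity>)\<close> are constrained.
\<close>

definition far_solution ::
    "real \<Rightarrow> ('a::{real_inner,banach} \<Rightarrow> 'b::real_inner) \<Rightarrow> 'b \<Rightarrow> (real \<Rightarrow> 'a) \<Rightarrow> bool" where
  "far_solution \<theta> A y x \<longleftrightarrow>
     continuous_on {0..} x \<and> caputo_differentiable \<theta> x \<and>
     (\<forall>t>0. caputo_derivative \<theta> x t + adjoint A (A (x t)) = adjoint A y) \<and>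
     x 0 = 0 \<and>
     (\<theta> > 1 \<longrightarrow> (x has_vector_derivative 0) (at 0 within {0..}))"

end

theory Submission
  imports Defs
begin

text \<open>
  The three generator conditions follow from the bounds on the Mittag-Leffler functions, as the
  bias \<open>1 - z E\<^bsub>\<theta>,\<theta>+1\<^esub>(-z)\<close> is \<open>E\<^sub>\<theta>(-z)\<close> and \<open>2 \<surd>\<mu> \<surd>\<alpha> \<le> \<alpha> + \<mu>\<close>.

  With \<open>T = A\<^sup>*A\<close> and \<open>b = A\<^sup>*y\<close>, the evolution equation is solved by the power series
  \<open>x(t) = t\<^sup>\<theta> E\<^bsub>\<theta>,\<theta>+1\<^esub>(-t\<^sup>\<theta> T) b\<close> in the bounded operator \<open>T\<close>: fractional integration of order
  \<open>a\<close> maps \<open>t\<^bsup>c-1\<^esup> E\<^bsub>\<theta>,c\<^esub>(-t\<^sup>\<theta> T) b\<close> to \<open>t\<^bsup>a+c-1\<^esup> E\<^bsub>\<theta>,a+c\<^esub>(-t\<^sup>\<theta> T) b\<close>. Solutions are unique because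
  the Caputo equation implies a Volterra equation (Abel inversion), for which a short-time
  contraction estimate applies repeatedly. Finally \<open>b\<close> is the sum of its projections onto the
  eigenspaces of \<open>T\<close>, by the spectral theorem, and on the eigenspace of \<open>\<mu>\<close> the power series is
  multiplication by the scalar \<open>g\<^sup>\<theta>(t, \<mu>)\<close>.
\<close>

subsection \<open>Orthogonal projections and the spectral theorem\<close>

text \<open>The obstacle is the point t = 0 combined with vector values. With n the ceiling of
  \<theta>, the n-th derivative of a solution may behave there like
  \<open>t powr (\<theta> - n)\<close>, and the Caputo integral is a gauge integral of a
  vector-valued function, whereas swapping two singular integrals asks for Fubini and so for
  Lebesgue integrability. Uniqueness is therefore proved after pairing with a fixed vector
  \<open>v\<close>, and the integrability of the norm demanded by
  \<open>caputo_differentiable\<close> supplies the dominating function. Inverting the fractional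
  integral leaves a boundary term, the limit at 0+ of the derivative of order n - 1, which the
  initial data must annihilate. Existence runs on the power series instead of the spectral sum
  because its terms integrate to Beta functions and it converges in norm, uniformly for bounded
  t.\<close>

lemma subspace_closure:
  fixes S :: "'a::real_normed_vector set"
  assumes "subspace S"
  shows "subspace (closure S)"
  unfolding subspace_def
proof (intro conjI ballI allI)
  show "0 \<in> closure S" using subspace_0[OF assms] closure_subset by blast
next
  fix x y assume "x \<in> closure S" "y \<in> closure S"
  then obtain f g where "\<And>n. f n \<in> S" "f \<longlonglongrightarrow> x" "\<And>n. g n \<in> S" "g \<longlonglongrightarrow> y"
    unfolding closure_sequential by blast
  then have "\<And>n. f n + g n \<in> S" "(\<lambda>n. f n + g n) \<longlonglongrightarrow> x + y"
    using assms by (auto intro: subspace_add tendsto_add)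
  then show "x + y \<in> closure S" unfolding closure_sequential by (intro exI[of _ "\<lambda>n. f n + g n"]) simp
next
  fix c x assume "x \<in> closure S"
  then obtain f where "\<And>n. f n \<in> S" "f \<longlonglongrightarrow> x"
    unfolding closure_sequential by blast
  then have "\<And>n. c *\<^sub>R f n \<in> S" "(\<lambda>n. c *\<^sub>R f n) \<longlonglongrightarrow> c *\<^sub>R x"
    using assms by (auto intro: subspace_scale tendsto_scaleR)
  then show "c *\<^sub>R x \<in> closure S" unfolding closure_sequential by (intro exI[of _ "\<lambda>n. c *\<^sub>R f n"]) simp
qed

text \<open>A minimizing sequence for the distance is Cauchy by the parallelogram law, since
  midpoints stay in \<open>V\<close>; completeness and closedness give a minimizer, and varying it
  along \<open>v\<close> forces orthogonality.\<close>

lemma exists_orthogonal_projection: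
  fixes V :: "'a::{real_inner,banach} set"
  assumes V: "subspace V" and cl: "closed V"
  shows "\<exists>p\<in>V. \<forall>v\<in>V. (x - p) \<bullet> v = 0"
proof -
  define d where "d = Inf ((\<lambda>v. (norm (x - v))\<^sup>2) ` V)"
  have ne: "V \<noteq> {}" using subspace_0[OF V] by auto
  have bdd: "bdd_below ((\<lambda>v. (norm (x - v))\<^sup>2) ` V)" by (rule bdd_belowI2[of _ 0]) simp
  have dle: "d \<le> (norm (x - v))\<^sup>2" if "v \<in> V" for v
    unfolding d_def using that bdd by (intro cInf_lower) auto
  have "\<exists>v\<in>V. (norm (x - v))\<^sup>2 < d + 1 / real (Suc n)" for n
  proof -
    have "Inf ((\<lambda>v. (norm (x - v))\<^sup>2) ` V) < d + 1 / real (Suc n)" by (simp add: d_def)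
    then show ?thesis using cInf_less_iff[of "(\<lambda>v. (norm (x - v))\<^sup>2) ` V"] ne bdd by auto
  qed
  then obtain f where f: "\<And>n. f n \<in> V" "\<And>n. (norm (x - f n))\<^sup>2 < d + 1 / real (Suc n)" by metis
  have par: "(norm (u - v))\<^sup>2 \<le> 2 * (norm (x - u))\<^sup>2 + 2 * (norm (x - v))\<^sup>2 - 4 * d"
    if "u \<in> V" "v \<in> V" for u v
  proof -
    have "(1/2) *\<^sub>R (u + v) \<in> V" using that V by (simp add: subspace_add subspace_scale)
    then have "4 * d \<le> 4 * (norm (x - (1/2) *\<^sub>R (u + v)))\<^sup>2" using dle by simp
    moreover have "(norm (u - v))\<^sup>2 + 4 * (norm (x - (1/2) *\<^sub>R (u + v)))\<^sup>2
        = 2 * (norm (x - u))\<^sup>2 + 2 * (norm (x - v))\<^sup>2"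
      unfolding power2_norm_eq_inner
      by (simp add: inner_diff_left inner_diff_right inner_add_left inner_add_right inner_commute algebra_simps)
    ultimately show ?thesis by linarith
  qed
  have lim0: "(\<lambda>n. 1 / real (Suc n)) \<longlonglongrightarrow> 0" by (rule LIMSEQ_Suc[OF lim_1_over_n])
  have "Cauchy f"
  proof (rule metric_CauchyI)
    fix e :: real assume e: "e > 0"
    have "eventually (\<lambda>n. 1 / real (Suc n) < e\<^sup>2 / 4) sequentially"
      using lim0 e by (intro order_tendstoD) auto
    then obtain N where N: "\<And>n. n \<ge> N \<Longrightarrow> 1 / real (Suc n) < e\<^sup>2 / 4"
      unfolding eventually_sequentially by auto
    show "\<exists>M. \<forall>m\<ge>M. \<forall>n\<ge>M. dist (f m) (f n) < e"
    proof (intro exI allI impI)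
      fix m n assume "m \<ge> N" "n \<ge> N"
      then have "(norm (f m - f n))\<^sup>2 < e\<^sup>2"
        using par[OF f(1)[of m] f(1)[of n]] f(2)[of m] f(2)[of n] N[of m] N[of n] by linarith
      then show "dist (f m) (f n) < e" using e by (simp add: dist_norm power2_less_imp_less)
    qed
  qed
  then obtain p where p: "f \<longlonglongrightarrow> p" using Cauchy_convergent convergent_def by blast
  have pV: "p \<in> V" using closed_sequentially[OF cl] f(1) p by blast
  have pd: "(norm (x - p))\<^sup>2 \<le> d"
  proof (rule LIMSEQ_le)
    show "(\<lambda>n. (norm (x - f n))\<^sup>2) \<longlonglongrightarrow> (norm (x - p))\<^sup>2" by (intro tendsto_intros p)
    show "(\<lambda>n. d + 1 / real (Suc n)) \<longlonglongrightarrow> d" using tendsto_add[OF tendsto_const lim0] by simp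
  qed (use f(2) less_imp_le in blast)
  have "(x - p) \<bullet> v = 0" if v: "v \<in> V" for v
  proof (cases "v = 0")
    case False
    \<comment> \<open>The best correction of \<open>p\<close> along \<open>v\<close>. It lowers the
      squared distance by the square of \<open>(x - p) \<bullet> v\<close> over
      \<open>v \<bullet> v\<close>, which minimality forces to be 0.\<close>
    define c where "c = (x - p) \<bullet> v / (v \<bullet> v)"
    have vv: "v \<bullet> v > 0" using False by simp
    have "p + c *\<^sub>R v \<in> V" using pV v V by (simp add: subspace_add subspace_scale)
    then have "(norm (x - p))\<^sup>2 \<le> (norm (x - (p + c *\<^sub>R v)))\<^sup>2" using order_trans[OF pd dle] by blast
    also have "\<dots> = (norm (x - p))\<^sup>2 - 2 * c * ((x - p) \<bullet> v) + c * c * (v \<bullet> v)"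
      unfolding power2_norm_eq_inner
      by (simp add: inner_diff_left inner_diff_right inner_add_left inner_add_right inner_commute algebra_simps)
    also have "c * c * (v \<bullet> v) = c * ((x - p) \<bullet> v)" using vv by (simp add: c_def)
    finally have "c * ((x - p) \<bullet> v) \<le> 0" by (simp add: algebra_simps)
    then have "((x - p) \<bullet> v)\<^sup>2 / (v \<bullet> v) \<le> 0" by (simp add: c_def power2_eq_square)
    then show ?thesis using vv by (simp add: divide_le_0_iff)
  qed simp
  with pV show ?thesis by blast
qed

lemma orthogonal_projection_works:
  fixes V :: "'a::{real_inner,banach} set"
  assumes V: "subspace V" and cl: "closed V"
  shows "orthogonal_projection V x \<in> V" "v \<in> V \<Longrightarrow> (x - orthogonal_projection V x) \<bullet> v = 0"
proof -
  have "\<exists>!p. p \<in> V \<and> (\<forall>v\<in>V. (x - p) \<bullet> v = 0)"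
  proof (rule ex_ex1I)
    fix p q assume pq: "p \<in> V \<and> (\<forall>v\<in>V. (x - p) \<bullet> v = 0)" "q \<in> V \<and> (\<forall>v\<in>V. (x - q) \<bullet> v = 0)"
    then have "p - q \<in> V" using V by (simp add: subspace_diff)
    then have "(x - p) \<bullet> (p - q) = 0" "(x - q) \<bullet> (p - q) = 0" using pq by auto
    then have "(p - q) \<bullet> (p - q) = 0" by (simp add: inner_diff_left)
    then show "p = q" by simp
  qed (use exists_orthogonal_projection[OF assms] in blast)
  from theI'[OF this] show "orthogonal_projection V x \<in> V"
    "v \<in> V \<Longrightarrow> (x - orthogonal_projection V x) \<bullet> v = 0"
    unfolding orthogonal_projection_def by auto
qed

section \<open>Riesz representation and the adjoint\<close>

text \<open>The kernel is a closed hyperplane. The residual of a point outside it, suitably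
  rescaled, represents \<open>f\<close>, because every \<open>x\<close> is a kernel element plus a
  multiple of that residual.\<close>

lemma riesz_representation:
  fixes f :: "'a::{real_inner,banach} \<Rightarrow> real"
  assumes "bounded_linear f"
  shows "\<exists>w. \<forall>x. f x = x \<bullet> w"
proof (cases "\<forall>x. f x = 0")
  case True
  then show ?thesis by (intro exI[of _ 0]) simp
next
  case False
  then obtain x0 where x0: "f x0 \<noteq> 0" by blast
  interpret bounded_linear f by fact
  define V where "V = {x. f x = 0}"
  have V: "subspace V" unfolding V_def subspace_def by (auto simp: add scaleR zero)
  have cl: "closed V" unfolding V_def
    by (intro closed_Collect_eq continuous_intros linear_continuous_on assms)
  from exists_orthogonal_projection[OF V cl, of x0] obtain p
    where p: "p \<in> V" "\<And>v. v \<in> V \<Longrightarrow> (x0 - p) \<bullet> v = 0" by blast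
  define w where "w = x0 - p"
  have fw: "f w \<noteq> 0" using x0 p(1) by (simp add: w_def diff V_def)
  then have ww: "w \<bullet> w \<noteq> 0" using zero by auto
  have "f x = x \<bullet> ((f w / (w \<bullet> w)) *\<^sub>R w)" for x
  proof -
    have "x - (f x / f w) *\<^sub>R w \<in> V" using fw by (simp add: V_def diff scaleR)
    then have "w \<bullet> (x - (f x / f w) *\<^sub>R w) = 0" using p(2) w_def by blast
    then have "x \<bullet> w = (f x / f w) * (w \<bullet> w)" by (simp add: inner_diff_right inner_commute)
    then show ?thesis using fw ww by (simp add: field_simps)
  qed
  then show ?thesis by blast
qed

text \<open>\<open>adjoint\<close> is defined by Hilbert choice, so a witness is required: Riesz is
  applied to the functional sending \<open>x\<close> to \<open>A x \<bullet> y\<close>, for one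
  \<open>y\<close> at a time.\<close>

lemma hilbert_adjoint_works:
  fixes A :: "'a::{real_inner,banach} \<Rightarrow> 'b::real_inner"
  assumes "bounded_linear A"
  shows "x \<bullet> adjoint A y = A x \<bullet> y"
proof -
  have "\<exists>w. \<forall>x. A x \<bullet> y = x \<bullet> w" for y
    by (intro riesz_representation bounded_linear_intros assms)
  then have "\<exists>f'. \<forall>x y. A x \<bullet> y = x \<bullet> f' y" by metis
  then have "\<forall>x y. A x \<bullet> y = x \<bullet> adjoint A y" unfolding adjoint_def by (rule someI_ex)
  then show ?thesis by simp
qed

lemma bounded_linear_hilbert_adjoint:
  fixes A :: "'a::{real_inner,banach} \<Rightarrow> 'b::real_inner"
  assumes "bounded_linear A"
  shows "bounded_linear (adjoint A)"
proof (rule bounded_linear_intro)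
  note w = hilbert_adjoint_works[OF assms]
  show "adjoint A (x + y) = adjoint A x + adjoint A y" for x y
    by (rule vector_eq_rdot[THEN iffD1]) (simp add: w inner_add_right inner_commute[of _ "_ \<bullet> _"]
      inner_commute[of "adjoint A _"] inner_add_left)
  show "adjoint A (r *\<^sub>R x) = r *\<^sub>R adjoint A x" for r x
    by (rule vector_eq_rdot[THEN iffD1]) (simp add: w inner_commute[of "adjoint A _"])
  fix y
  have "norm (adjoint A y) * norm (adjoint A y) = A (adjoint A y) \<bullet> y"
    using w[of "adjoint A y" y] by (simp add: power2_norm_eq_inner[symmetric] power2_eq_square)
  also have "\<dots> \<le> norm (A (adjoint A y)) * norm y" by (rule norm_cauchy_schwarz)
  also have "\<dots> \<le> onorm A * norm (adjoint A y) * norm y"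
    by (intro mult_right_mono onorm assms) simp
  finally show "norm (adjoint A y) \<le> norm y * onorm A"
    using onorm_pos_le[OF assms]
    by (cases "norm (adjoint A y) = 0") (auto simp: mult.commute mult.left_commute)
qed

section \<open>Eigenspaces and completeness of the eigenvectors\<close>

lemma closed_eigenspace:
  fixes T :: "'a::{real_inner,banach} \<Rightarrow> 'a"
  assumes "bounded_linear T"
  shows "subspace (eigenspace T \<mu>)" "closed (eigenspace T \<mu>)"
proof -
  interpret bounded_linear T by fact
  show "subspace (eigenspace T \<mu>)"
    unfolding eigenspace_def subspace_def by (auto simp: add scaleR zero algebra_simps)
  show "closed (eigenspace T \<mu>)" unfolding eigenspace_def
    by (intro closed_Collect_eq continuous_intros linear_continuous_on assms)
qed

lemma eigenspace_orthogonal: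
  fixes T :: "'a::real_inner \<Rightarrow> 'a"
  assumes sa: "\<And>x y. T x \<bullet> y = x \<bullet> T y"
    and "x \<in> eigenspace T \<mu>" "y \<in> eigenspace T \<nu>" "\<mu> \<noteq> \<nu>"
  shows "x \<bullet> y = 0"
  using sa[of x y] assms(2-) by (auto simp: eigenspace_def)

text \<open>The eigenvector is a limit of unit vectors of \<open>V\<close> that maximise the norm of \<open>A x\<close>.\<close>

lemma compact_operator_eigenvector:
  fixes A :: "'a::{real_inner,banach} \<Rightarrow> 'b::{real_inner,banach}"
  assumes A: "compact_operator A" and V: "subspace V" "closed V"
    and inv: "\<And>x. x \<in> V \<Longrightarrow> adjoint A (A x) \<in> V"
    and v: "v \<in> V" "A v \<noteq> 0"
  shows "\<exists>e\<in>V. e \<noteq> 0 \<and> (\<exists>\<mu>. adjoint A (A e) = \<mu> *\<^sub>R e)"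
proof -
  have bl: "bounded_linear A" using A by (simp add: compact_operator_def)
  note bl' = bounded_linear_hilbert_adjoint[OF bl]
  interpret A: bounded_linear A by fact
  interpret A': bounded_linear "adjoint A" by fact
  note w = hilbert_adjoint_works[OF bl]
  define U where "U = {x \<in> V. norm x = 1}"
  define M where "M = (SUP x\<in>U. norm (A x))"
  have v0: "v \<noteq> 0" using v A.zero by auto
  define v1 where "v1 = (1 / norm v) *\<^sub>R v"
  have v1: "v1 \<in> U" using v v0 V(1) by (simp add: U_def v1_def subspace_scale)
  have bdd: "bdd_above ((\<lambda>x. norm (A x)) ` U)"
  proof (rule bdd_aboveI2)
    fix x assume "x \<in> U"
    then show "norm (A x) \<le> onorm A" using onorm[OF bl, of x] by (simp add: U_def)
  qed
  have MU: "norm (A x) \<le> M" if "x \<in> U" for x unfolding M_def by (rule cSUP_upper[OF that bdd])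
  have "norm (A v1) > 0" using v v0 by (simp add: v1_def A.scaleR)
  then have M0: "M > 0" using MU[OF v1] by linarith
  have MV: "norm (A x) \<le> M * norm x" if "x \<in> V" for x
  proof (cases "x = 0")
    case False
    then have "(1 / norm x) *\<^sub>R x \<in> U" using that V(1) by (simp add: U_def subspace_scale)
    from MU[OF this] False show ?thesis by (simp add: A.scaleR field_simps)
  qed (simp add: A.zero)
  \<comment> \<open>Invariance of \<open>V\<close> lets the constant of \<open>A\<close> on
    \<open>V\<close> be used a second time, for the vector \<open>adjoint A (A x)\<close>.\<close>
  have TV: "norm (adjoint A (A x)) \<le> M\<^sup>2 * norm x" if "x \<in> V" for x
  proof -
    let ?y = "adjoint A (A x)"
    have "norm ?y * norm ?y = A ?y \<bullet> A x"
      using w[of ?y "A x"] by (simp add: power2_norm_eq_inner[symmetric] power2_eq_square)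
    also have "\<dots> \<le> norm (A ?y) * norm (A x)" by (rule norm_cauchy_schwarz)
    also have "\<dots> \<le> (M * norm ?y) * (M * norm x)"
      by (intro mult_mono MV inv that mult_nonneg_nonneg less_imp_le[OF M0]) auto
    finally have "norm ?y * norm ?y \<le> norm ?y * (M\<^sup>2 * norm x)"
      by (simp add: power2_eq_square algebra_simps)
    then show ?thesis by (cases "norm ?y = 0") auto
  qed
  have "\<exists>x\<in>U. M - 1 / real (Suc n) < norm (A x)" for n
    using less_cSUP_iff[of U "\<lambda>x. norm (A x)" "M - 1 / real (Suc n)"] v1 bdd
    by (auto simp: M_def[symmetric])
  then obtain f where f: "\<And>n. f n \<in> U" "\<And>n. M - 1 / real (Suc n) < norm (A (f n))" by metis
  have lim0: "(\<lambda>n. 1 / real (Suc n)) \<longlonglongrightarrow> 0" by (rule LIMSEQ_Suc[OF lim_1_over_n])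
  have limM: "(\<lambda>n. norm (A (f n))) \<longlonglongrightarrow> M"
  proof (rule real_tendsto_sandwich[where f = "\<lambda>n. M - 1 / real (Suc n)" and h = "\<lambda>_. M"])
    show "(\<lambda>n. M - 1 / real (Suc n)) \<longlonglongrightarrow> M" using tendsto_diff[OF tendsto_const lim0] by simp
      show "\<forall>\<^sub>F n in sequentially. M - 1 / real (Suc n) \<le> norm (A (f n))"
      by (intro always_eventually allI less_imp_le f(2))
    show "\<forall>\<^sub>F n in sequentially. norm (A (f n)) \<le> M" by (intro always_eventually allI MU f(1))
  qed simp
  \<comment> \<open>Expanding the square, the inner product in the cross term is the squared norm of
    \<open>A (f n)\<close>, which tends to M^2, while the two other terms are at most M^4. So
    near-maximizers are near-eigenvectors for M^2.\<close>
  have defect: "(\<lambda>n. adjoint A (A (f n)) - M\<^sup>2 *\<^sub>R f n) \<longlonglongrightarrow> 0"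
  proof -
    have le: "(norm (adjoint A (A (f n)) - M\<^sup>2 *\<^sub>R f n))\<^sup>2 \<le> 2 * M^4 - 2 * M\<^sup>2 * (norm (A (f n)))\<^sup>2" for n
    proof -
      have fn: "f n \<in> V" "norm (f n) = 1" using f(1)[of n] by (auto simp: U_def)
      have "(norm (adjoint A (A (f n)) - M\<^sup>2 *\<^sub>R f n))\<^sup>2
        = (norm (adjoint A (A (f n))))\<^sup>2 - 2 * M\<^sup>2 * (f n \<bullet> adjoint A (A (f n))) + M\<^sup>2 * M\<^sup>2 * (norm (f n))\<^sup>2"
        unfolding power2_norm_eq_inner
        by (simp add: inner_diff_left inner_diff_right inner_commute algebra_simps)
      also have "(norm (adjoint A (A (f n))))\<^sup>2 \<le> (M\<^sup>2)\<^sup>2"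
        using TV[OF fn(1)] fn(2) by (intro power_mono) auto
      finally show ?thesis using fn(2) w[of "f n" "A (f n)"]
        by (simp add: power2_norm_eq_inner[symmetric] power4_eq_xxxx power2_eq_square algebra_simps)
    qed
    have "(\<lambda>n. 2 * M^4 - 2 * M\<^sup>2 * (norm (A (f n)))\<^sup>2) \<longlonglongrightarrow> 2 * M^4 - 2 * M\<^sup>2 * M\<^sup>2"
      by (intro tendsto_intros limM)
    then have "(\<lambda>n. 2 * M^4 - 2 * M\<^sup>2 * (norm (A (f n)))\<^sup>2) \<longlonglongrightarrow> 0"
      by (simp add: power4_eq_xxxx power2_eq_square)
    then have "(\<lambda>n. (norm (adjoint A (A (f n)) - M\<^sup>2 *\<^sub>R f n))\<^sup>2) \<longlonglongrightarrow> 0"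
      by (rule tendsto_sandwich[OF _ _ tendsto_const, rotated 2]) (use le in auto)
    from tendsto_real_sqrt[OF this] show ?thesis by (simp add: tendsto_norm_zero_iff)
  qed
  have "bounded U" unfolding bounded_iff U_def by auto
  then have "compact (closure (A ` U))" using A by (simp add: compact_operator_def)
  moreover have "\<forall>n. A (f n) \<in> closure (A ` U)" using f(1) closure_subset by blast
  ultimately obtain l r where r: "strict_mono r" "(\<lambda>n. A (f (r n))) \<longlonglongrightarrow> l"
    unfolding compact_eq_seq_compact_metric seq_compact_def o_def by meson
  \<comment> \<open>Compactness makes only the images \<open>A (f (r n))\<close> converge. As M^2
    times \<open>f (r n)\<close> is its image under \<open>adjoint A \<circ> A\<close> minus the
    vanishing defect, and M > 0, the vectors themselves converge to this \<open>e\<close>.\<close>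
  define e where "e = (1 / M\<^sup>2) *\<^sub>R adjoint A l"
  have lT: "(\<lambda>n. adjoint A (A (f (r n)))) \<longlonglongrightarrow> adjoint A l" by (rule A'.tendsto[OF r(2)])
  have "(\<lambda>n. (1 / M\<^sup>2) *\<^sub>R (adjoint A (A (f (r n))) - (adjoint A (A (f (r n))) - M\<^sup>2 *\<^sub>R f (r n))))
      \<longlonglongrightarrow> (1 / M\<^sup>2) *\<^sub>R (adjoint A l - 0)"
    using LIMSEQ_subseq_LIMSEQ[OF defect r(1)] by (intro tendsto_intros lT) (simp add: o_def)
  then have le: "(\<lambda>n. f (r n)) \<longlonglongrightarrow> e" using M0 by (simp add: e_def)
  have eV: "e \<in> V" using closed_sequentially[OF V(2) _ le] f(1) U_def by auto
  have "(\<lambda>n. norm (f (r n))) \<longlonglongrightarrow> norm e" by (intro tendsto_intros le)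
  then have "norm e = 1" using f(1) by (simp add: U_def LIMSEQ_const_iff)
  moreover have "(\<lambda>n. adjoint A (A (f (r n)))) \<longlonglongrightarrow> adjoint A (A e)"
    by (intro A'.tendsto A.tendsto le)
  then have "adjoint A (A e) = adjoint A l" by (rule LIMSEQ_unique[OF _ lT])
  then have "adjoint A (A e) = M\<^sup>2 *\<^sub>R e" using M0 by (simp add: e_def)
  ultimately show ?thesis using eV by (intro bexI[of _ e]) auto
qed

text \<open>The orthogonal complement \<open>W\<close> of all eigenvectors is closed and invariant,
  so an element of \<open>W\<close> on which \<open>A\<close> does not vanish would produce an
  eigenvector inside \<open>W\<close>, hence orthogonal to itself. Nonzero elements killed by
  \<open>A\<close> are themselves eigenvectors, for the eigenvalue 0.\<close>

lemma eigenvectors_dense: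
  fixes A :: "'a::{real_inner,banach} \<Rightarrow> 'b::{real_inner,banach}"
  assumes A: "compact_operator A"
  defines "T \<equiv> adjoint A \<circ> A"
  shows "closure (span (\<Union>\<mu>\<in>eigenvalues T. eigenspace T \<mu>)) = UNIV"
proof -
  define E where "E = (\<Union>\<mu>\<in>eigenvalues T. eigenspace T \<mu>)"
  have bl: "bounded_linear A" using A by (simp add: compact_operator_def)
  interpret A: bounded_linear A by fact
  interpret A': bounded_linear "adjoint A" by (rule bounded_linear_hilbert_adjoint[OF bl])
  note w = hilbert_adjoint_works[OF bl]
  have sa: "T x \<bullet> y = x \<bullet> T y" for x y
    using w[of y "A x"] w[of x "A y"] by (simp add: T_def inner_commute)
  define W where "W = {x. \<forall>y\<in>E. x \<bullet> y = 0}"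
  have E_I: "x \<in> E" if "T x = \<mu> *\<^sub>R x" "x \<noteq> 0" for x \<mu>
    using that by (auto simp: E_def eigenspace_def eigenvalues_def)
  have sW: "subspace W" by (auto simp: W_def subspace_def inner_add_left)
  have cW: "closed W"
  proof -
    have "W = (\<Inter>y\<in>E. {x. x \<bullet> y = 0})" by (auto simp: W_def)
    then show ?thesis by (auto intro!: closed_INT closed_Collect_eq continuous_intros)
  qed
  have inv: "adjoint A (A x) \<in> W" if "x \<in> W" for x
  proof -
    have "T x \<bullet> y = 0" if "y \<in> E" for y
      using that \<open>x \<in> W\<close> unfolding sa by (auto simp: E_def W_def eigenspace_def)
    then show ?thesis by (simp add: W_def T_def)
  qed
  have W0: "x = 0" if x: "x \<in> W" for x
  proof (cases "A x = 0")
    case True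
    then have "T x = 0 *\<^sub>R x" by (simp add: T_def A'.zero)
    then have "x \<noteq> 0 \<Longrightarrow> x \<in> E" by (rule E_I)
    then have "x \<noteq> 0 \<Longrightarrow> x \<bullet> x = 0" using x by (auto simp: W_def)
    then show ?thesis by auto
  next
    case False
    from compact_operator_eigenvector[OF A sW cW inv x False] obtain e \<mu>
      where e: "e \<in> W" "e \<noteq> 0" "adjoint A (A e) = \<mu> *\<^sub>R e" by blast
    then have "e \<in> E" by (intro E_I[of _ \<mu>]) (auto simp: T_def)
    then show ?thesis using e by (auto simp: W_def)
  qed
  have "x \<in> closure (span E)" for x
  proof -
    from exists_orthogonal_projection[OF subspace_closure[OF subspace_span] closed_closure, of E x] obtain p
      where p: "p \<in> closure (span E)" "\<And>v. v \<in> closure (span E) \<Longrightarrow> (x - p) \<bullet> v = 0"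
      by blast
    have "E \<subseteq> closure (span E)" using closure_subset span_superset by (metis order_trans)
    then have "x - p \<in> W" using p(2) unfolding W_def by blast
    from W0[OF this] show ?thesis using p(1) by simp
  qed
  then show ?thesis by (auto simp: E_def)
qed

text \<open>For a finite set of eigenvalues the partial sum is the best approximation of
  \<open>b\<close> from the span of their eigenspaces. Density of the eigenvectors then gives
  convergence along the finite subsets.\<close>

theorem has_sum_eigenspace_projections:
  fixes A :: "'a::{real_inner,banach} \<Rightarrow> 'b::{real_inner,banach}"
  assumes A: "compact_operator A"
  defines "T \<equiv> adjoint A \<circ> A"
  shows "((\<lambda>\<mu>. orthogonal_projection (eigenspace T \<mu>) b) has_sum b) (eigenvalues T)"
proof -
  have bl: "bounded_linear A" using A by (simp add: compact_operator_def)
  have blT: "bounded_linear T" unfolding T_def o_def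
    by (rule bounded_linear_compose[OF bounded_linear_hilbert_adjoint[OF bl] bl])
  note w = hilbert_adjoint_works[OF bl]
  have sa: "T x \<bullet> y = x \<bullet> T y" for x y
    using w[of y "A x"] w[of x "A y"] by (simp add: T_def inner_commute)
  note orth = eigenspace_orthogonal[of T, OF sa]
  note P = orthogonal_projection_works[OF closed_eigenspace[OF blT]]
  define P where "P \<mu> = orthogonal_projection (eigenspace T \<mu>)" for \<mu>
  note P = P[folded P_def]
  define S where "S F = span (\<Union>\<mu>\<in>F. eigenspace T \<mu>)" for F
  have S_PF: "(\<Sum>\<mu>\<in>F. P \<mu> b) \<in> S F" for F
    unfolding S_def by (intro span_sum span_base) (use P in blast)
  \<comment> \<open>By linearity a single eigenvector suffices as test vector; orthogonality of the
    eigenspaces leaves only the projection belonging to its eigenvalue.\<close>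
  have resid: "(b - (\<Sum>\<mu>\<in>F. P \<mu> b)) \<bullet> v = 0" if F: "finite F" and v: "v \<in> S F" for F v
    using v unfolding S_def
  proof (induction rule: span_induct)
    case base
    then show ?case by (auto simp: subspace_def inner_add_right)
  next
    case (step v)
    then obtain \<nu> where \<nu>: "\<nu> \<in> F" "v \<in> eigenspace T \<nu>" by blast
    have "(\<Sum>\<mu>\<in>F. P \<mu> b) \<bullet> v = (\<Sum>\<mu>\<in>F. if \<mu> = \<nu> then P \<nu> b \<bullet> v else 0)"
      unfolding inner_sum_left by (intro sum.cong refl) (auto intro: orth[OF P(1) \<nu>(2)])
    also have "\<dots> = P \<nu> b \<bullet> v" using \<nu> F by simp
    finally show ?case using P(2)[OF \<nu>(2), of b] by (simp add: inner_diff_left)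
  qed
  have best: "norm (b - (\<Sum>\<mu>\<in>F. P \<mu> b)) \<le> norm (b - p)" if F: "finite F" and p: "p \<in> S F" for F p
  proof -
    let ?q = "\<Sum>\<mu>\<in>F. P \<mu> b"
    have "?q - p \<in> S F" using S_PF p unfolding S_def by (intro span_diff) auto
    then have "(b - ?q) \<bullet> (?q - p) = 0" by (rule resid[OF F])
    then have "(norm (b - p))\<^sup>2 = (norm (b - ?q))\<^sup>2 + (norm (?q - p))\<^sup>2"
      using norm_add_Pythagorean[of "b - ?q" "?q - p"] by (simp add: orthogonal_def)
    then have "(norm (b - ?q))\<^sup>2 \<le> (norm (b - p))\<^sup>2" by simp
    then show ?thesis by (rule power2_le_imp_le) simp
  qed
  have "((\<lambda>\<mu>. P \<mu> b) has_sum b) (eigenvalues T)"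
    unfolding has_sum_def tendsto_iff eventually_finite_subsets_at_top
  proof (intro allI impI)
    fix \<epsilon> :: real assume "\<epsilon> > 0"
    then obtain p where p: "p \<in> S (eigenvalues T)" "dist p b < \<epsilon>"
      using eigenvectors_dense[OF A] unfolding S_def T_def closure_approachable
      by (metis (no_types, lifting) UNIV_I closure_approachable)
    from p(1) obtain B r where B: "finite B" "B \<subseteq> (\<Union>\<mu>\<in>eigenvalues T. eigenspace T \<mu>)"
      "p = (\<Sum>a\<in>B. r a *\<^sub>R a)" unfolding S_def span_explicit by auto
    from B(2) obtain m where m: "\<And>a. a \<in> B \<Longrightarrow> m a \<in> eigenvalues T \<and> a \<in> eigenspace T (m a)"
      by (metis (no_types, lifting) UN_iff subsetD)
    show "\<exists>X. finite X \<and> X \<subseteq> eigenvalues T \<and>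
      (\<forall>Y. finite Y \<and> X \<subseteq> Y \<and> Y \<subseteq> eigenvalues T \<longrightarrow> dist (\<Sum>\<mu>\<in>Y. P \<mu> b) b < \<epsilon>)"
    \<comment> \<open>The eigenvalues occurring in the approximant \<open>p\<close> form the
      threshold set: \<open>p\<close> lies in the span for every larger finite set
      \<open>Y\<close>.\<close>
    proof (intro exI[of _ "m ` B"] conjI allI impI)
      fix Y assume Y: "finite Y \<and> m ` B \<subseteq> Y \<and> Y \<subseteq> eigenvalues T"
      have "p \<in> S Y" unfolding B(3) S_def
        by (intro span_sum span_scale span_base) (use m Y in blast)
      then have "norm (b - (\<Sum>\<mu>\<in>Y. P \<mu> b)) \<le> norm (b - p)" using best Y by blast
      then show "dist (\<Sum>\<mu>\<in>Y. P \<mu> b) b < \<epsilon>" using p(2) by (simp add: dist_norm norm_minus_commute)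
    qed (use B m in auto)
  qed
  then show ?thesis by (simp add: P_def)
qed

subsection \<open>Mittag-Leffler functions of a real variable\<close>

text \<open>\<open>x\<close> is the convex combination of \<open>x - 1\<close> and
  \<open>x + \<theta>\<close> with weight \<open>l\<close> on the latter. Log-convexity of Gamma and
  Gamma x = (x - 1) Gamma (x - 1) then yield this growth, which drives the ratio test below.\<close>

lemma Gamma_add_ge:
  fixes x \<theta> :: real
  assumes x: "x > 1" and \<theta>: "\<theta> > 0"
  shows "(x - 1) powr \<theta> * Gamma x \<le> Gamma (x + \<theta>)"
proof -
  define l where "l = 1 / (1 + \<theta>)"
  have l: "0 \<le> l" "l \<le> 1" "(1 + \<theta>) * l = 1" using \<theta> by (auto simp: l_def field_simps)
  have "(ln \<circ> Gamma) ((1 - l) *\<^sub>R (x - 1) + l *\<^sub>R (x + \<theta>)) \<le> (1 - l) * (ln \<circ> Gamma) (x - 1) + l * (ln \<circ> Gamma) (x + \<theta>)"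
    by (rule convex_onD[OF log_convex_Gamma_real]) (use l x \<theta> in auto)
  also have "(1 - l) *\<^sub>R (x - 1) + l *\<^sub>R (x + \<theta>) = x - 1 + (1 + \<theta>) * l" by (simp add: algebra_simps)
  finally have "ln (Gamma x) \<le> (1 - l) * ln (Gamma (x - 1)) + l * ln (Gamma (x + \<theta>))"
    using l by simp
  then have "(1 + \<theta>) * ln (Gamma x) \<le> (1 + \<theta>) * ((1 - l) * ln (Gamma (x - 1)) + l * ln (Gamma (x + \<theta>)))"
    using \<theta> by (intro mult_left_mono) auto
  also have "\<dots> = (1 + \<theta> - (1 + \<theta>) * l) * ln (Gamma (x - 1)) + ((1 + \<theta>) * l) * ln (Gamma (x + \<theta>))"
    by (simp add: algebra_simps)
  finally have "(1 + \<theta>) * ln (Gamma x) \<le> \<theta> * ln (Gamma (x - 1)) + ln (Gamma (x + \<theta>))"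
    unfolding l(3) by simp
  moreover have "ln (Gamma x) = ln (x - 1) + ln (Gamma (x - 1))"
  proof -
    have g: "Gamma (x - 1) > 0" by (rule Gamma_real_pos) (use x in simp)
    have "x - 1 \<notin> \<int>\<^sub>\<le>\<^sub>0" using nonpos_Ints_nonpos[of "x - 1"] x by force
    from Gamma_plus1[OF this] have "Gamma x = (x - 1) * Gamma (x - 1)" by simp
    then show ?thesis using ln_mult_pos[OF _ g, of "x - 1"] x by simp
  qed
  ultimately have "\<theta> * ln (x - 1) + ln (Gamma x) \<le> ln (Gamma (x + \<theta>))" by (simp add: algebra_simps)
  moreover have "ln ((x - 1) powr \<theta> * Gamma x) = \<theta> * ln (x - 1) + ln (Gamma x)"
    using ln_mult_pos[of "(x - 1) powr \<theta>" "Gamma x"] x by (simp add: ln_powr)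
  ultimately show ?thesis
    using x \<theta> by (subst ln_le_cancel_iff[symmetric]) auto
qed

lemma summable_mittag_leffler:
  fixes \<theta> c z :: real
  assumes \<theta>: "\<theta> > 0" and c: "c > 0"
  shows "summable (\<lambda>k. z ^ k / Gamma (\<theta> * real k + c))"
proof -
  \<comment> \<open>The factor 2 produces the ratio 1/2; the summand 1 keeps \<open>K\<close>
    positive.\<close>
  define K where "K = 2 * \<bar>z\<bar> + 1"
  have K: "K > 0" by (simp add: K_def add_nonneg_pos)
  obtain N :: nat where N: "real N * \<theta> > 1 + K powr (1 / \<theta>)"
    using reals_Archimedean3[OF \<theta>] by metis
  show ?thesis
  proof (rule summable_ratio_test[of "1/2" N])
    fix k assume k: "k \<ge> N"
    define x where "x = \<theta> * real k + c"
    have "real N * \<theta> \<le> real k * \<theta>" using k \<theta> by (intro mult_right_mono) auto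
    then have x: "x - 1 > K powr (1 / \<theta>)" using N c by (simp add: x_def mult.commute)
    then have x1: "x > 1" using powr_ge_zero[of K "1 / \<theta>"] by linarith
    have "K = (K powr (1 / \<theta>)) powr \<theta>" using K \<theta> by (simp add: powr_powr)
    also have "\<dots> \<le> (x - 1) powr \<theta>" using x \<theta> by (intro powr_mono2) auto
    finally have "2 * \<bar>z\<bar> \<le> (x - 1) powr \<theta>" by (simp add: K_def)
    then have "2 * \<bar>z\<bar> * Gamma x \<le> (x - 1) powr \<theta> * Gamma x" using x1 by (intro mult_right_mono) auto
    also have "\<dots> \<le> Gamma (x + \<theta>)" by (rule Gamma_add_ge[OF x1 \<theta>])
    finally have "\<bar>z\<bar> / Gamma (x + \<theta>) \<le> 1 / 2 * (1 / Gamma x)"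
      using x1 \<theta> by (simp add: field_simps Gamma_real_pos)
    then have "\<bar>z\<bar> ^ k * (\<bar>z\<bar> / Gamma (x + \<theta>)) \<le> \<bar>z\<bar> ^ k * (1 / 2 * (1 / Gamma x))"
      by (intro mult_left_mono) auto
    moreover have "\<theta> * real (Suc k) + c = x + \<theta>" by (simp add: x_def algebra_simps)
    ultimately show "norm (z ^ Suc k / Gamma (\<theta> * real (Suc k) + c)) \<le> 1 / 2 * norm (z ^ k / Gamma (\<theta> * real k + c))"
      using x1 \<theta> by (simp add: x_def[symmetric] power_abs abs_mult mult.commute)
  qed simp
qed

lemma mittag_leffler_recurrence:
  assumes \<theta>: "\<theta> > 0" and c: "c > 0"
  shows "mittag_leffler \<theta> c z = 1 / Gamma c + z * mittag_leffler \<theta> (\<theta> + c) z"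
proof -
  have "(\<Sum>k. z ^ Suc k / Gamma (\<theta> * real (Suc k) + c)) = mittag_leffler \<theta> c z - 1 / Gamma c"
    using suminf_split_head[OF summable_mittag_leffler[OF assms, of z]] by (simp add: mittag_leffler_def)
  moreover have "(\<Sum>k. z ^ Suc k / Gamma (\<theta> * real (Suc k) + c))
      = (\<Sum>k. z * (z ^ k / Gamma (\<theta> * real k + (\<theta> + c))))"
    by (intro suminf_cong) (simp add: algebra_simps)
  moreover have "\<dots> = z * mittag_leffler \<theta> (\<theta> + c) z"
    unfolding mittag_leffler_def by (rule suminf_mult) (use summable_mittag_leffler assms in simp)
  ultimately show ?thesis by simp
qed

lemma far_generator_eq:
  assumes "\<theta> > 0" "\<alpha> > 0"
  shows "far_generator \<theta> \<alpha> \<mu> = inverse \<alpha> * mittag_leffler \<theta> (\<theta> + 1) (- \<mu> * inverse \<alpha>)"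
proof -
  have "(\<alpha> powr (- 1 / \<theta>)) powr \<theta> = inverse \<alpha>"
    using assms powr_powr[of \<alpha> "- 1 / \<theta>" \<theta>] by (simp add: powr_minus_divide divide_inverse)
  then show ?thesis by (simp add: far_generator_def far_time_generator_def)
qed

lemma bias_far_generator:
  assumes "\<theta> > 0" "\<alpha> > 0"
  shows "bias (far_generator \<theta>) \<alpha> \<mu> = mittag_leffler \<theta> 1 (- (\<mu> / \<alpha>))"
  using mittag_leffler_recurrence[OF assms(1), of 1 "- (\<mu> / \<alpha>)"]
  by (simp add: bias_def far_generator_eq[OF assms] field_simps)

section \<open>The three generator conditions\<close>

lemma generator_function_far:
  assumes \<theta>: "\<theta> > 0" and C: "C > 0"
    and b1: "\<And>z. z \<ge> 0 \<Longrightarrow> \<bar>mittag_leffler \<theta> (\<theta> + 1) (- z)\<bar> \<le> C / (1 + z)"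
    and b2: "\<And>z. z \<ge> 0 \<Longrightarrow> \<bar>mittag_leffler \<theta> 1 (- z)\<bar> \<le> C / (1 + z)"
  shows "generator_bound A \<alpha>bar (far_generator \<theta>) (C / 2)"
    and "generator_function A \<alpha>bar (far_generator \<theta>)"
proof -
  show bound: "generator_bound A \<alpha>bar (far_generator \<theta>) (C / 2)"
    unfolding generator_bound_def
  proof (intro ballI)
    fix \<mu> \<alpha> :: real assume "\<mu> \<in> {0<..(onorm A)\<^sup>2}" "\<alpha> \<in> {0<..\<alpha>bar}"
    then have pos: "\<mu> > 0" "\<alpha> > 0" by auto
    have "\<bar>far_generator \<theta> \<alpha> \<mu>\<bar> = inverse \<alpha> * \<bar>mittag_leffler \<theta> (\<theta> + 1) (- (\<mu> / \<alpha>))\<bar>"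
      using pos by (simp add: far_generator_eq[OF \<theta> pos(2)] abs_mult divide_inverse)
    also have "\<dots> \<le> inverse \<alpha> * (C / (1 + \<mu> / \<alpha>))" using pos by (intro mult_left_mono b1) auto
    also have "\<dots> = C / (\<alpha> + \<mu>)" using pos by (simp add: field_simps)
    finally have "sqrt \<mu> * \<bar>far_generator \<theta> \<alpha> \<mu>\<bar> \<le> sqrt \<mu> * (C / (\<alpha> + \<mu>))"
      using pos by (intro mult_left_mono) auto
    also have "\<dots> \<le> C / 2 / sqrt \<alpha>"
    proof -
      \<comment> \<open>This inequality of means is the source of the factor 1/2 in the
        constant.\<close>
      have "0 \<le> (sqrt \<alpha> - sqrt \<mu>)\<^sup>2" by simp
      then have "2 * (sqrt \<mu> * sqrt \<alpha>) \<le> \<alpha> + \<mu>" using pos by (simp add: power2_diff algebra_simps)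
      then have "C * (2 * (sqrt \<mu> * sqrt \<alpha>)) \<le> C * (\<alpha> + \<mu>)" using C by (intro mult_left_mono) auto
      then show ?thesis using pos by (simp add: field_simps)
    qed
    finally show "sqrt \<mu> * \<bar>far_generator \<theta> \<alpha> \<mu>\<bar> \<le> C / 2 / sqrt \<alpha>" .
  qed
  have bias_le: "\<bar>bias (far_generator \<theta>) \<alpha> \<mu>\<bar> \<le> C / (1 + \<mu> / \<alpha>)" if "\<alpha> > 0" "\<mu> > 0" for \<alpha> \<mu>
    unfolding bias_far_generator[OF \<theta> that(1)] using that by (intro b2) auto
  have "((\<lambda>\<alpha>. \<bar>bias (far_generator \<theta>) \<alpha> \<mu>\<bar>) \<longlongrightarrow> 0) (at_right 0)" if \<mu>: "\<mu> > 0" for \<mu>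
  proof (rule tendsto_sandwich[where f = "\<lambda>_. 0" and h = "\<lambda>\<alpha>. C * \<alpha> / (\<alpha> + \<mu>)"])
    show "\<forall>\<^sub>F \<alpha> in at_right 0. \<bar>bias (far_generator \<theta>) \<alpha> \<mu>\<bar> \<le> C * \<alpha> / (\<alpha> + \<mu>)"
      unfolding eventually_at_right_field
    proof (intro exI[of _ 1] conjI allI impI)
      fix \<alpha> :: real assume "0 < \<alpha>" "\<alpha> < 1"
      then show "\<bar>bias (far_generator \<theta>) \<alpha> \<mu>\<bar> \<le> C * \<alpha> / (\<alpha> + \<mu>)"
        using bias_le[of \<alpha> \<mu>] \<mu> by (simp add: field_simps)
    qed simp
    have "((\<lambda>\<alpha>. C * \<alpha> / (\<alpha> + \<mu>)) \<longlongrightarrow> C * 0 / (0 + \<mu>)) (at_right 0)"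
      using \<mu> by (intro tendsto_intros) auto
    then show "((\<lambda>\<alpha>. C * \<alpha> / (\<alpha> + \<mu>)) \<longlongrightarrow> 0) (at_right 0)" by simp
  qed auto
  moreover have "\<bar>bias (far_generator \<theta>) \<alpha> \<mu>\<bar> \<le> C" if "\<alpha> > 0" "\<mu> > 0" for \<alpha> \<mu>
  proof -
    have "C / (1 + \<mu> / \<alpha>) \<le> C / 1" using that C by (intro divide_left_mono) (auto intro: add_pos_nonneg)
    then show ?thesis using bias_le[OF that] by simp
  qed
  ultimately show "generator_function A \<alpha>bar (far_generator \<theta>)"
    unfolding generator_function_def using bound C
    by (intro conjI ballI exI[of _ C] exI[of _ "C/2"]) auto
qed

subsection \<open>Mittag-Leffler functions of a bounded operator\<close>

text \<open>The weight may be unbounded, as fractional kernels are. In a Riemann sum, replacing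
  \<open>F n\<close> by \<open>f\<close> costs at most the uniform error times the Riemann sum of
  \<open>w\<close>, which stays below \<open>W + 1\<close> for fine divisions.\<close>

lemma has_integral_weighted_uniform_limit:
  fixes w :: "real \<Rightarrow> real" and F :: "nat \<Rightarrow> real \<Rightarrow> 'a::real_normed_vector"
  assumes w: "(w has_integral W) {a..b}" and w0: "\<And>s. s \<in> {a..b} \<Longrightarrow> w s \<ge> 0"
    and F: "uniform_limit {a..b} F f sequentially"
    and I: "\<And>n. ((\<lambda>s. w s *\<^sub>R F n s) has_integral I n) {a..b}" and J: "I \<longlonglongrightarrow> J"
  shows "((\<lambda>s. w s *\<^sub>R f s) has_integral J) {a..b}"
  unfolding has_integral_real
proof (intro allI impI)
  fix e :: real assume e: "e > 0"
  have W0: "W \<ge> 0" by (rule has_integral_nonneg[OF w w0])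
  \<comment> \<open>Makes the replacement error at most e/4; the Riemann sum of \<open>F n\<close>
    and the distance of \<open>I n\<close> from \<open>J\<close> take another e/4 each.\<close>
  define \<eta> where "\<eta> = e / (4 * (W + 1))"
  have \<eta>: "\<eta> > 0" "\<eta> * (W + 1) = e / 4" using e W0 by (auto simp: \<eta>_def field_simps)
  have "\<forall>\<^sub>F n in sequentially. (\<forall>s\<in>{a..b}. dist (F n s) (f s) < \<eta>) \<and> dist (I n) J < e / 4"
    using uniform_limitD[OF F \<eta>(1)] tendstoD[OF J, of "e/4"] e by (auto intro: eventually_conj)
  from eventually_happens'[OF sequentially_bot this]
  obtain n where n: "\<And>s. s \<in> {a..b} \<Longrightarrow> dist (F n s) (f s) < \<eta>" "dist (I n) J < e / 4"
    by blast
  have "\<exists>\<gamma>. gauge \<gamma> \<and> (\<forall>D. D tagged_division_of {a..b} \<and> \<gamma> fine D \<longrightarrow>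
      norm ((\<Sum>(x,k)\<in>D. measure lborel k *\<^sub>R (w x *\<^sub>R F n x)) - I n) < e / 4)"
    by (rule I[of n, unfolded has_integral_real, rule_format]) (use e in simp)
  then obtain \<gamma>1 where \<gamma>1: "gauge \<gamma>1"
    "\<forall>D. D tagged_division_of {a..b} \<and> \<gamma>1 fine D \<longrightarrow>
      norm ((\<Sum>(x,k)\<in>D. measure lborel k *\<^sub>R (w x *\<^sub>R F n x)) - I n) < e / 4"
    by (elim exE conjE)
  have "\<exists>\<gamma>. gauge \<gamma> \<and> (\<forall>D. D tagged_division_of {a..b} \<and> \<gamma> fine D \<longrightarrow>
      norm ((\<Sum>(x,k)\<in>D. measure lborel k *\<^sub>R w x) - W) < 1)"
    by (rule w[unfolded has_integral_real, rule_format]) simp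
  then obtain \<gamma>2 where \<gamma>2: "gauge \<gamma>2"
    "\<forall>D. D tagged_division_of {a..b} \<and> \<gamma>2 fine D \<longrightarrow>
      norm ((\<Sum>(x,k)\<in>D. measure lborel k *\<^sub>R w x) - W) < 1"
    by (elim exE conjE)
  show "\<exists>\<gamma>. gauge \<gamma> \<and> (\<forall>D. D tagged_division_of {a..b} \<and> \<gamma> fine D \<longrightarrow>
      norm ((\<Sum>(x,k)\<in>D. measure lborel k *\<^sub>R (w x *\<^sub>R f x)) - J) < e)"
  proof (intro exI[of _ "\<lambda>x. \<gamma>1 x \<inter> \<gamma>2 x"] conjI allI impI gauge_Int \<gamma>1 \<gamma>2)
    fix D assume D: "D tagged_division_of {a..b} \<and> (\<lambda>x. \<gamma>1 x \<inter> \<gamma>2 x) fine D"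
    then have D1: "norm ((\<Sum>(x,k)\<in>D. measure lborel k *\<^sub>R (w x *\<^sub>R F n x)) - I n) < e / 4"
      and D2: "norm ((\<Sum>(x,k)\<in>D. measure lborel k *\<^sub>R w x) - W) < 1"
      using \<gamma>1(2) \<gamma>2(2) by (auto simp: fine_Int)
    let ?d = "(\<Sum>(x,k)\<in>D. measure lborel k *\<^sub>R (w x *\<^sub>R f x)) - (\<Sum>(x,k)\<in>D. measure lborel k *\<^sub>R (w x *\<^sub>R F n x))"
    have "?d = (\<Sum>(x,k)\<in>D. measure lborel k *\<^sub>R (w x *\<^sub>R (f x - F n x)))"
      unfolding sum_subtractf[symmetric] by (intro sum.cong) (auto simp: algebra_simps)
    also have "norm \<dots> \<le> (\<Sum>(x,k)\<in>D. \<eta> * (measure lborel k * w x))"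
    proof (rule sum_norm_le)
      fix p assume "p \<in> D"
      moreover obtain x k where p: "p = (x, k)" by (cases p)
      ultimately have "x \<in> {a..b}" using D tagged_division_ofD(2,3) by (metis subsetD)
      then have "norm (f x - F n x) \<le> \<eta>" "w x \<ge> 0"
        using n(1)[of x] w0 by (auto simp: dist_norm norm_minus_commute)
      then have "measure lborel k * w x * norm (f x - F n x) \<le> measure lborel k * w x * \<eta>"
        by (intro mult_left_mono) auto
      then show "norm (case p of (x, k) \<Rightarrow> measure lborel k *\<^sub>R (w x *\<^sub>R (f x - F n x)))
          \<le> (case p of (x, k) \<Rightarrow> \<eta> * (measure lborel k * w x))"
        using \<open>w x \<ge> 0\<close> by (simp add: p mult.commute mult.left_commute)
    qed
    also have "\<dots> = \<eta> * (\<Sum>(x,k)\<in>D. measure lborel k *\<^sub>R w x)"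
      by (simp add: sum_distrib_left case_prod_unfold)
    also have "\<dots> \<le> \<eta> * (W + 1)" using D2 \<eta>(1) by (intro mult_left_mono) auto
    finally have "norm ?d \<le> e / 4" using \<eta>(2) by simp
    moreover have "norm (I n - J) < e / 4" using n(2) by (simp add: dist_norm)
    ultimately have "norm (?d + ((\<Sum>(x,k)\<in>D. measure lborel k *\<^sub>R (w x *\<^sub>R F n x)) - I n) + (I n - J)) < e"
      using D1 e by (intro order.strict_trans1[OF norm_triangle_ineq] order.strict_trans1[OF add_right_mono[OF norm_triangle_ineq]]) simp
    then show "norm ((\<Sum>(x,k)\<in>D. measure lborel k *\<^sub>R (w x *\<^sub>R f x)) - J) < e" by simp
  qed
qed

lemma has_integral_beta_kernel:
  fixes a c s t :: real
  assumes a: "a > 0" and c: "c > 0" and st: "s < t"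
  shows "((\<lambda>r. (t - r) powr (a - 1) * (r - s) powr (c - 1)) has_integral (t - s) powr (a + c - 1) * Beta a c) {s..t}"
proof -
  define m where "m = 1 / (t - s)"
  have m: "m > 0" using st by (simp add: m_def)
  have "((\<lambda>x. (m *\<^sub>R x + - s * m) powr (c - 1) * (1 - (m *\<^sub>R x + - s * m)) powr (a - 1)) has_integral (Beta c a /\<^sub>R m ^ DIM(real)))
      (cbox ((0 - - s * m) /\<^sub>R m) ((1 - - s * m) /\<^sub>R m))"
    using has_integral_affinity'[OF has_integral_Beta_real[OF c a, unfolded box_real[symmetric]] m, of "- s * m"] .
  moreover have "(1 - - s * m) /\<^sub>R m = t" "(0 - - s * m) /\<^sub>R m = s" using st by (auto simp: m_def field_simps)
  ultimately have "((\<lambda>x. (m * x - s * m) powr (c - 1) * (1 - (m * x - s * m)) powr (a - 1)) has_integral (Beta c a * (t - s))) {s..t}"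
    by (simp add: m_def mult.commute)
  \<comment> \<open>This factor undoes the normalization of both powers, the total exponent being (a
    - 1) + (c - 1); the Jacobian contributes the remaining factor t - s.\<close>
  from has_integral_mult_right[OF this, of "(t - s) powr (a + c - 2)"]
  have *: "((\<lambda>x. (t - s) powr (a + c - 2) * ((m * x - s * m) powr (c - 1) * (1 - (m * x - s * m)) powr (a - 1)))
      has_integral ((t - s) powr (a + c - 2) * (Beta c a * (t - s)))) {s..t}" .
  have "(t - s) powr (a + c - 2) * (Beta c a * (t - s)) = (t - s) powr (a + c - 1) * Beta a c"
  proof -
    have "(t - s) powr (a + c - 2) * (t - s) = (t - s) powr (a + c - 1)"
      using st powr_mult_base[of "t - s" "a + c - 2"] by (simp add: mult.commute)
    then show ?thesis by (simp only: Beta_commute[of c a] mult.left_commute[of _ "Beta a c"]) (simp only: mult.commute)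
  qed
  moreover have "(t - s) powr (a + c - 2) * ((m * x - s * m) powr (c - 1) * (1 - (m * x - s * m)) powr (a - 1))
      = (t - x) powr (a - 1) * (x - s) powr (c - 1)" if "x \<in> {s..t}" for x
  proof -
    have "m * x - s * m = (x - s) / (t - s)" "1 - (m * x - s * m) = (t - x) / (t - s)"
      using st by (simp_all add: m_def diff_divide_distrib[symmetric], simp add: field_simps)
    then have "(m * x - s * m) powr (c - 1) * (1 - (m * x - s * m)) powr (a - 1)
        = (x - s) powr (c - 1) / (t - s) powr (c - 1) * ((t - x) powr (a - 1) / (t - s) powr (a - 1))"
      using that st by (simp add: powr_divide)
    moreover have "(t - s) powr (a + c - 2) = (t - s) powr (c - 1) * (t - s) powr (a - 1)"
      by (simp add: powr_add[symmetric] algebra_simps)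
    ultimately show ?thesis using st by simp
  qed
  ultimately show ?thesis using * by (subst has_integral_cong[symmetric]) auto
qed

text \<open>Stands for E_{\<theta>,c}(-z T) b; the sign is built in because it is evaluated at
  \<open>z = t powr \<theta>\<close>. The series makes sense for every bounded \<open>T\<close>,
  without spectral theory.\<close>

definition mittag_leffler_op :: "real \<Rightarrow> real \<Rightarrow> ('a::real_normed_vector \<Rightarrow> 'a) \<Rightarrow> 'a \<Rightarrow> real \<Rightarrow> 'a" where
  "mittag_leffler_op \<theta> c T b z = (\<Sum>k. ((- z) ^ k / Gamma (\<theta> * real k + c)) *\<^sub>R (T ^^ k) b)"

lemma norm_funpow_le:
  fixes T :: "'a::real_normed_vector \<Rightarrow> 'a"
  assumes "bounded_linear T"
  shows "norm ((T ^^ k) b) \<le> onorm T ^ k * norm b"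
proof (induction k)
  case (Suc k)
  have "norm (T ((T ^^ k) b)) \<le> onorm T * norm ((T ^^ k) b)" by (rule onorm[OF assms])
  also have "\<dots> \<le> onorm T * (onorm T ^ k * norm b)"
    by (intro mult_left_mono Suc onorm_pos_le assms)
  finally show ?case by (simp add: mult.assoc)
qed simp

context
  fixes \<theta> :: real and T :: "'a::banach \<Rightarrow> 'a"
  assumes \<theta>: "\<theta> > 0" and T: "bounded_linear T"
begin

text \<open>The majorant is the scalar series at \<open>R * onorm T\<close>. Its convergence for
  every \<open>R\<close> yields summability, uniform convergence on bounded sets and the norm
  bound.\<close>

lemma norm_mittag_leffler_term_le:
  assumes "c > 0" "\<bar>z\<bar> \<le> R"
  shows "norm (((- z) ^ k / Gamma (\<theta> * real k + c)) *\<^sub>R (T ^^ k) b)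
    \<le> (R * onorm T) ^ k / Gamma (\<theta> * real k + c) * norm b"
proof -
  have G: "Gamma (\<theta> * real k + c) > 0" using \<theta> assms by (intro Gamma_real_pos add_nonneg_pos) auto
  have "\<bar>z\<bar> ^ k * norm ((T ^^ k) b) \<le> R ^ k * (onorm T ^ k * norm b)"
    using assms by (intro mult_mono power_mono norm_funpow_le T) auto
  then show ?thesis using G
    by (simp add: power_abs divide_right_mono power_mult_distrib mult.assoc)
qed

lemma summable_mittag_leffler_bound:
  assumes "c > 0"
  shows "summable (\<lambda>k. (R * onorm T) ^ k / Gamma (\<theta> * real k + c) * norm (b::'a))"
  by (intro summable_mult2 summable_mittag_leffler \<theta> assms)

lemma summable_mittag_leffler_op:
  assumes "c > 0"
  shows "summable (\<lambda>k. ((- z) ^ k / Gamma (\<theta> * real k + c)) *\<^sub>R (T ^^ k) b)"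
  by (rule summable_comparison_test'[OF summable_mittag_leffler_bound[OF assms]])
     (rule norm_mittag_leffler_term_le[OF assms order_refl])

lemma uniform_limit_mittag_leffler_op:
  assumes "c > 0"
  shows "uniform_limit {-R..R} (\<lambda>n z. \<Sum>k<n. ((- z) ^ k / Gamma (\<theta> * real k + c)) *\<^sub>R (T ^^ k) b)
    (mittag_leffler_op \<theta> c T b) sequentially"
  unfolding mittag_leffler_op_def
  by (rule Weierstrass_m_test[OF _ summable_mittag_leffler_bound[OF assms, of R b]])
     (rule norm_mittag_leffler_term_le[OF assms], auto)

lemma isCont_mittag_leffler_op:
  assumes "c > 0"
  shows "isCont (mittag_leffler_op \<theta> c T b) z"
proof -
  let ?R = "\<bar>z\<bar> + 1"
  have "continuous_on {-?R..?R} (mittag_leffler_op \<theta> c T b)"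
  proof (rule uniform_limit_theorem[OF _ uniform_limit_mittag_leffler_op[OF assms]])
    show "\<forall>\<^sub>F n in sequentially. continuous_on {-?R..?R}
        (\<lambda>z. \<Sum>k<n. ((- z) ^ k / Gamma (\<theta> * real k + c)) *\<^sub>R (T ^^ k) b)"
      unfolding divide_inverse by (intro always_eventually allI continuous_intros)
  qed simp
  then show ?thesis by (rule continuous_on_interior) auto
qed

lemma continuous_on_mittag_leffler_op:
  assumes "c > 0" "continuous_on S f"
  shows "continuous_on S (\<lambda>x. mittag_leffler_op \<theta> c T b (f x))"
  by (rule continuous_on_compose2[OF _ assms(2), of UNIV])
     (auto intro: continuous_at_imp_continuous_on isCont_mittag_leffler_op assms)

lemma norm_mittag_leffler_op_le:
  assumes "c > 0"
  shows "norm (mittag_leffler_op \<theta> c T b z) \<le> norm b * mittag_leffler \<theta> c (\<bar>z\<bar> * onorm T)"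
proof -
  let ?f = "\<lambda>k. ((- z) ^ k / Gamma (\<theta> * real k + c)) *\<^sub>R (T ^^ k) b"
  note B = summable_mittag_leffler_bound[OF assms, of "\<bar>z\<bar>" b]
  note le = norm_mittag_leffler_term_le[OF assms order_refl, of z _ b]
  have S: "summable (\<lambda>k. norm (?f k))"
    by (rule summable_comparison_test'[OF B]) (use le in simp)
  have "norm (mittag_leffler_op \<theta> c T b z) \<le> (\<Sum>k. norm (?f k))"
    unfolding mittag_leffler_op_def by (rule summable_norm[OF S])
  also have "\<dots> \<le> (\<Sum>k. (\<bar>z\<bar> * onorm T) ^ k / Gamma (\<theta> * real k + c) * norm b)"
    by (rule suminf_le[OF le S B])
  also have "\<dots> = norm b * mittag_leffler \<theta> c (\<bar>z\<bar> * onorm T)"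
    unfolding mittag_leffler_def
    by (subst suminf_mult2[symmetric]) (auto intro: summable_mittag_leffler \<theta> assms simp: mult.commute)
  finally show ?thesis .
qed

lemma linear_funpow: "linear (T ^^ k)"
proof (induction k)
  case (Suc k)
  from linear_compose[OF Suc bounded_linear.linear[OF T]] show ?case unfolding funpow.simps .
qed (simp add: linear_id[unfolded id_def] id_def)

text \<open>Boundedness in \<open>b\<close> is what later moves the operator inside the infinite sum
  over the eigenspaces.\<close>

lemma bounded_linear_mittag_leffler_op:
  assumes c: "c > 0"
  shows "bounded_linear (\<lambda>b. mittag_leffler_op \<theta> c T b z)"
proof (rule bounded_linear_intro)
  note s = summable_mittag_leffler_op[OF c]
  show "mittag_leffler_op \<theta> c T (x + y) z = mittag_leffler_op \<theta> c T x z + mittag_leffler_op \<theta> c T y z" for x y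
    unfolding mittag_leffler_op_def suminf_add[OF s s]
    by (simp add: linear_add[OF linear_funpow] scaleR_add_right)
  show "mittag_leffler_op \<theta> c T (r *\<^sub>R x) z = r *\<^sub>R mittag_leffler_op \<theta> c T x z" for r x
    unfolding mittag_leffler_op_def suminf_scaleR_right[OF s]
    by (simp add: linear_scale[OF linear_funpow] mult.commute)
  show "norm (mittag_leffler_op \<theta> c T x z) \<le> norm x * mittag_leffler \<theta> c (\<bar>z\<bar> * onorm T)" for x
    by (rule norm_mittag_leffler_op_le[OF c])
qed

lemma mittag_leffler_op_eigenvector:
  assumes "c > 0" "T v = \<mu> *\<^sub>R v"
  shows "mittag_leffler_op \<theta> c T v z = mittag_leffler \<theta> c (- \<mu> * z) *\<^sub>R v"
proof -
  have p: "(T ^^ k) v = \<mu> ^ k *\<^sub>R v" for k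
    by (induction k) (auto simp: linear_scale[OF bounded_linear.linear[OF T]] assms(2))
  show ?thesis unfolding mittag_leffler_op_def mittag_leffler_def p
    by (subst suminf_scaleR_left[OF summable_mittag_leffler[OF \<theta> assms(1)]])
       (simp add: power_mult_distrib[symmetric] mult.commute)
qed

text \<open>At \<open>c = 1\<close> this becomes the evolution equation itself, once the Caputo
  derivative is known to be the series with second index 1.\<close>

lemma mittag_leffler_op_recurrence:
  assumes c: "c > 0"
  shows "mittag_leffler_op \<theta> c T b z = (1 / Gamma c) *\<^sub>R b - z *\<^sub>R T (mittag_leffler_op \<theta> (\<theta> + c) T b z)"
proof -
  have c': "\<theta> + c > 0" using \<theta> c by simp
  let ?h = "\<lambda>k. ((- z) ^ k / Gamma (\<theta> * real k + c)) *\<^sub>R (T ^^ k) b"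
  let ?g = "\<lambda>k. ((- z) ^ k / Gamma (\<theta> * real k + (\<theta> + c))) *\<^sub>R (T ^^ k) b"
  have bl: "bounded_linear (\<lambda>v. - z *\<^sub>R T v)"
    by (intro bounded_linear_scaleR_right[THEN bounded_linear_compose] T)
  have "(\<Sum>k. ?h (Suc k)) = mittag_leffler_op \<theta> c T b z - (1 / Gamma c) *\<^sub>R b"
    using suminf_split_head[OF summable_mittag_leffler_op[OF c, of z b]] by (simp add: mittag_leffler_op_def)
  moreover have "(\<Sum>k. ?h (Suc k)) = (\<Sum>k. - z *\<^sub>R T (?g k))"
    by (intro suminf_cong) (simp add: linear_scale[OF bounded_linear.linear[OF T]] algebra_simps)
  moreover have "\<dots> = - z *\<^sub>R T (mittag_leffler_op \<theta> (\<theta> + c) T b z)"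
    unfolding mittag_leffler_op_def
    by (rule bounded_linear.suminf[OF bl summable_mittag_leffler_op[OF c'], symmetric])
  ultimately show ?thesis by (simp add: algebra_simps)
qed

text \<open>Each term is a Beta integral: \<open>Beta a (\<theta> * k + c)\<close> over
  \<open>Gamma (\<theta> * k + c)\<close> equals \<open>Gamma a\<close> over
  \<open>Gamma (\<theta> * k + a + c)\<close>, so \<open>Gamma a\<close> factors out and the second
  index shifts by \<open>a\<close>.\<close>

lemma fractional_integral_mittag_leffler_op:
  assumes a: "a > 0" and c: "c > 0" and t: "t > 0"
  shows "((\<lambda>s. (t - s) powr (a - 1) *\<^sub>R s powr (c - 1) *\<^sub>R mittag_leffler_op \<theta> c T b (s powr \<theta>))
    has_integral Gamma a *\<^sub>R t powr (a + c - 1) *\<^sub>R mittag_leffler_op \<theta> (a + c) T b (t powr \<theta>)) {0..t}"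
proof -
  let ?w = "\<lambda>s. (t - s) powr (a - 1) * s powr (c - 1)"
  let ?F = "\<lambda>n s. \<Sum>k<n. ((- (s powr \<theta>)) ^ k / Gamma (\<theta> * real k + c)) *\<^sub>R (T ^^ k) b"
  let ?t = "\<lambda>k. ((- (t powr \<theta>)) ^ k / Gamma (\<theta> * real k + (a + c))) *\<^sub>R (T ^^ k) b"
  let ?m = "Gamma a * t powr (a + c - 1)"
  have ac: "a + c > 0" using a c by simp
  have w: "(?w has_integral (t powr (a + c - 1) * Beta a c)) {0..t}"
    using has_integral_beta_kernel[OF a c t] by simp
  have "((\<lambda>s. ?w s *\<^sub>R mittag_leffler_op \<theta> c T b (s powr \<theta>)) has_integral
     ?m *\<^sub>R mittag_leffler_op \<theta> (a + c) T b (t powr \<theta>)) {0..t}"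
  proof (rule has_integral_weighted_uniform_limit[OF w, of ?F _ "\<lambda>n. \<Sum>k<n. ?m *\<^sub>R ?t k"])
    show "uniform_limit {0..t} ?F (\<lambda>s. mittag_leffler_op \<theta> c T b (s powr \<theta>)) sequentially"
    proof (rule uniform_limit_compose'[OF uniform_limit_mittag_leffler_op[OF c, where R = "t powr \<theta>"]])
      have "- (t powr \<theta>) \<le> s powr \<theta>" for s
        using powr_ge_zero[of t \<theta>] powr_ge_zero[of s \<theta>] by linarith
      then show "(\<lambda>s. s powr \<theta>) \<in> {0..t} \<rightarrow> {- (t powr \<theta>)..t powr \<theta>}"
        using \<theta> by (auto intro!: powr_mono2)
    qed
    show "((\<lambda>s. ?w s *\<^sub>R ?F n s) has_integral (\<Sum>k<n. ?m *\<^sub>R ?t k)) {0..t}" for n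
      unfolding scaleR_sum_right
    proof (intro has_integral_sum finite_lessThan)
      fix k
      have ck: "\<theta> * real k + c > 0" using \<theta> c by (intro add_nonneg_pos) auto
      \<comment> \<open>The side condition excludes the one clash of conventions,
        \<open>0 ^ 0 = 1\<close> against \<open>0 powr 0 = 0\<close>.\<close>
      have e: "((t powr \<theta>) ^ k) = t powr (\<theta> * real k)" if "t \<ge> 0" "k > 0 \<or> t > 0" for t :: real
        using that by (cases "t = 0") (auto simp: powr_powr powr_realpow[symmetric])
      have "((\<lambda>s. ((-1) ^ k / Gamma (\<theta> * real k + c)) *\<^sub>R
          ((t - s) powr (a - 1) * (s - 0) powr ((\<theta> * real k + c) - 1)) *\<^sub>R (T ^^ k) b) has_integral
         ((-1) ^ k / Gamma (\<theta> * real k + c)) *\<^sub>R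
          ((t - 0) powr (a + (\<theta> * real k + c) - 1) * Beta a (\<theta> * real k + c)) *\<^sub>R (T ^^ k) b) {0..t}"
        by (intro has_integral_cmul has_integral_scaleR_left has_integral_beta_kernel a ck t)
      also have "((-1) ^ k / Gamma (\<theta> * real k + c)) *\<^sub>R
          ((t - 0) powr (a + (\<theta> * real k + c) - 1) * Beta a (\<theta> * real k + c)) *\<^sub>R (T ^^ k) b = ?m *\<^sub>R ?t k"
      proof -
        have "Gamma (\<theta> * real k + c) > 0" using ck by simp
        moreover have "t powr (a + (\<theta> * real k + c) - 1) = t powr (a + c - 1) * (t powr \<theta>) ^ k"
          using t by (simp add: e powr_add[symmetric] algebra_simps)
        ultimately show ?thesis
          by (simp add: Beta_def power_minus[of "t powr \<theta>"] algebra_simps)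
      qed
      finally show "((\<lambda>s. ?w s *\<^sub>R ((- (s powr \<theta>)) ^ k / Gamma (\<theta> * real k + c)) *\<^sub>R (T ^^ k) b) has_integral ?m *\<^sub>R ?t k) {0..t}"
      proof (rule has_integral_eq[rotated])
        fix s assume s: "s \<in> {0..t}"
        show "((-1) ^ k / Gamma (\<theta> * real k + c)) *\<^sub>R
          ((t - s) powr (a - 1) * (s - 0) powr ((\<theta> * real k + c) - 1)) *\<^sub>R (T ^^ k) b
          = ?w s *\<^sub>R ((- (s powr \<theta>)) ^ k / Gamma (\<theta> * real k + c)) *\<^sub>R (T ^^ k) b"
        \<comment> \<open>At s = 0 both sides vanish, since every \<open>powr\<close> with base 0 is
          0.\<close>
        proof (cases "s = 0")
          case False
          then have "s powr ((\<theta> * real k + c) - 1) = s powr (c - 1) * (s powr \<theta>) ^ k"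
            using s by (simp add: e powr_add[symmetric] algebra_simps)
          then show ?thesis by (simp add: power_minus[of "s powr \<theta>"] algebra_simps)
        qed simp
      qed
    qed
    show "(\<lambda>n. \<Sum>k<n. ?m *\<^sub>R ?t k) \<longlonglongrightarrow> ?m *\<^sub>R mittag_leffler_op \<theta> (a + c) T b (t powr \<theta>)"
      unfolding mittag_leffler_op_def scaleR_sum_right[symmetric]
      by (intro tendsto_intros summable_LIMSEQ summable_mittag_leffler_op ac)
  qed simp
  then show ?thesis by (simp add: mult.assoc)
qed

text \<open>The case \<open>a = 1\<close> of the previous formula replaces differentiating the series term by term.\<close>

lemma has_vector_derivative_mittag_leffler_op:
  assumes c: "c > 0" and t: "t > 0"
  shows "((\<lambda>s. s powr c *\<^sub>R mittag_leffler_op \<theta> (c + 1) T b (s powr \<theta>)) has_vector_derivative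
    t powr (c - 1) *\<^sub>R mittag_leffler_op \<theta> c T b (t powr \<theta>)) (at t)"
proof -
  let ?g = "\<lambda>s. s powr (c - 1) *\<^sub>R mittag_leffler_op \<theta> c T b (s powr \<theta>)"
  have I: "(?g has_integral s powr c *\<^sub>R mittag_leffler_op \<theta> (c + 1) T b (s powr \<theta>)) {0..s}" if "s > 0" for s
  \<comment> \<open>The kernel with exponent \<open>1 - 1\<close> is constantly 1 except at the
    endpoint, where \<open>0 powr 0 = 0\<close>.\<close>
  proof (rule has_integral_spike_finite)
    show "((\<lambda>r. (s - r) powr (1 - 1) *\<^sub>R r powr (c - 1) *\<^sub>R mittag_leffler_op \<theta> c T b (r powr \<theta>))
       has_integral s powr c *\<^sub>R mittag_leffler_op \<theta> (c + 1) T b (s powr \<theta>)) {0..s}"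
      using fractional_integral_mittag_leffler_op[OF zero_less_one c that] by (simp add: add.commute)
    show "?g r = (s - r) powr (1 - 1) *\<^sub>R r powr (c - 1) *\<^sub>R mittag_leffler_op \<theta> c T b (r powr \<theta>)"
      if "r \<in> {0..s} - {s}" for r using that by simp
  qed simp
  \<comment> \<open>For c < 1 the integrand is singular at 0, so the fundamental theorem is applied
    only from t/2 on and the integral up to t/2 enters as a constant.\<close>
  have cont: "continuous_on {t/2..2*t} ?g"
    using t by (intro continuous_intros continuous_on_mittag_leffler_op c) auto
  have "((\<lambda>u. integral {0..t/2} ?g + integral {t/2..u} ?g) has_vector_derivative 0 + ?g t) (at t within {t/2..2*t})"
    using t by (intro has_vector_derivative_add has_vector_derivative_const integral_has_vector_derivative cont) auto
  then have "((\<lambda>s. s powr c *\<^sub>R mittag_leffler_op \<theta> (c + 1) T b (s powr \<theta>)) has_vector_derivative ?g t) (at t within {t/2..2*t})"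
  proof (rule has_vector_derivative_transform[rotated 2, OF has_vector_derivative_eq_rhs])
    fix u assume u: "u \<in> {t/2..2*t}"
    have "integral {0..t/2} ?g + integral {t/2..u} ?g = integral {0..u} ?g"
      using u t by (intro Henstock_Kurzweil_Integration.integral_combine has_integral_integrable[OF I]) auto
    also have "\<dots> = u powr c *\<^sub>R mittag_leffler_op \<theta> (c + 1) T b (u powr \<theta>)"
      using u t by (intro integral_unique I) auto
    finally show "u powr c *\<^sub>R mittag_leffler_op \<theta> (c + 1) T b (u powr \<theta>) = integral {0..t/2} ?g + integral {t/2..u} ?g" ..
  qed (use t in auto)
  then show ?thesis using t by (simp add: at_within_Icc_at)
qed

end

subsection \<open>From the Caputo equation to a Volterra equation\<close>

text \<open>Fubini needs this kernel as a Lebesgue integral over the whole line. As the kernel is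
  nonnegative, its gauge integral transfers; the exponents -a and a - 1 leave no power of T -
  s.\<close>

lemma has_bochner_integral_beta_kernel:
  fixes a s T :: real
  assumes a: "0 < a" "a < 1" and sT: "s < T"
  shows "has_bochner_integral lborel
    (\<lambda>t. if s < t \<and> t < T then (T - t) powr (- a) * (t - s) powr (a - 1) else 0) (Gamma a * Gamma (1 - a))"
proof (rule has_bochner_integral_nn_integral)
  let ?k = "\<lambda>t. if s < t \<and> t < T then (T - t) powr (- a) * (t - s) powr (a - 1) else 0"
  have "((\<lambda>t. (T - t) powr (- a) * (t - s) powr (a - 1)) has_integral (Gamma a * Gamma (1 - a))) {s..T}"
    using has_integral_beta_kernel[of "1 - a" a s T] assms by (simp add: Beta_def mult.commute)
  then have "(?k has_integral (Gamma a * Gamma (1 - a))) {s..T}"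
    by (rule has_integral_spike_finite[of "{s, T}", rotated 2]) auto
  then have "(?k has_integral (Gamma a * Gamma (1 - a))) UNIV"
    by (rule has_integral_on_superset) auto
  then show "(\<integral>\<^sup>+t. ennreal (?k t) \<partial>lborel) = ennreal (Gamma a * Gamma (1 - a))"
    by (intro nn_integral_has_integral_lborel) auto
qed (use a in \<open>auto\<close>)

text \<open>By Fubini, the kernel of the composition is the Beta integral of the two kernels, which is
  constant because the orders \<open>a\<close> and \<open>1 - a\<close> add up to 1.\<close>

lemma abel_inversion:
  fixes \<phi> h :: "real \<Rightarrow> real"
  assumes a: "0 < a" "a < 1" and T: "T > 0"
    and m[measurable]: "\<phi> \<in> borel_measurable borel"
    and i: "integrable lborel (\<lambda>s. indicator {0<..<T} s * \<phi> s)"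
    and conv: "\<And>t. 0 < t \<Longrightarrow> t < T \<Longrightarrow> ((\<lambda>s. (t - s) powr (a - 1) * \<phi> s) has_integral h t) {0..t}"
  shows "((\<lambda>t. (T - t) powr (- a) * h t) has_integral
    Gamma a * Gamma (1 - a) * (\<integral>s. indicator {0<..<T} s * \<phi> s \<partial>lborel)) {0..T}"
proof -
  define B where "B = Gamma a * Gamma (1 - a)"
  define k where "k s t = (if s < t \<and> t < T then (T - t) powr (- a) * (t - s) powr (a - 1) else 0)" for s t
  define f where "f s t = indicator {0<..<T} s * \<phi> s * k s t" for s t
  have k: "has_bochner_integral lborel (k s) B" if "s < T" for s
    unfolding B_def k_def by (rule has_bochner_integral_beta_kernel[OF a that])
  have k0: "k s t \<ge> 0" for s t by (simp add: k_def)
  have f_m: "case_prod f \<in> borel_measurable (lborel \<Otimes>\<^sub>M lborel)"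
    unfolding f_def k_def case_prod_unfold by measurable
  have f_t: "has_bochner_integral lborel (f s) (indicator {0<..<T} s * \<phi> s * B)" for s
  proof (cases "s < T")
    case True
    then show ?thesis unfolding f_def by (intro has_bochner_integral_mult_right k)
  next
    case False
    then have "f s = (\<lambda>_. 0)" by (auto simp: f_def)
    then show ?thesis using False by (simp add: has_bochner_integral_zero)
  qed
  have nf_t: "has_bochner_integral lborel (\<lambda>t. norm (f s t)) (indicator {0<..<T} s * \<bar>\<phi> s\<bar> * B)" for s
  proof (cases "s < T")
    case True
    then have "has_bochner_integral lborel (\<lambda>t. (indicator {0<..<T} s * \<bar>\<phi> s\<bar>) * k s t) (indicator {0<..<T} s * \<bar>\<phi> s\<bar> * B)"
      by (intro has_bochner_integral_mult_right k)
    then show ?thesis by (simp add: f_def abs_mult k0)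
  next
    case False
    then have "f s = (\<lambda>_. 0)" by (auto simp: f_def)
    then show ?thesis using False by (simp add: has_bochner_integral_zero)
  qed
  \<comment> \<open>In absolute value each \<open>s\<close> carries kernel mass \<open>B\<close>, so
    joint integrability reduces to that of \<phi> on \<open>{0<..<T}\<close>.\<close>
  have f_i: "integrable (lborel \<Otimes>\<^sub>M lborel) (case_prod f)"
  proof (rule lborel_pair.Fubini_integrable[OF f_m])
    have "integrable lborel (\<lambda>s. norm (indicator {0<..<T} s * \<phi> s) * B)"
      by (intro integrable_mult_left integrable_norm i)
    then show "integrable lborel (\<lambda>s. \<integral>t. norm (case_prod f (s, t)) \<partial>lborel)"
      by (simp only: prod.case has_bochner_integral_integral_eq[OF nf_t]) (simp add: abs_mult)
    show "AE s in lborel. integrable lborel (\<lambda>t. case_prod f (s, t))"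
      using f_t by (auto simp: has_bochner_integral_iff)
  qed
  define G where "G t = (\<integral>s. f s t \<partial>lborel)" for t
  have "(G has_integral (\<integral>t. G t \<partial>lborel)) UNIV"
    unfolding G_def by (intro has_integral_integral_real lborel_pair.integrable_snd f_i)
  also have "(\<integral>t. G t \<partial>lborel) = (\<integral>s. (\<integral>t. f s t \<partial>lborel) \<partial>lborel)"
    unfolding G_def by (rule lborel_pair.Fubini_integral[OF f_i])
  also have "\<dots> = B * (\<integral>s. indicator {0<..<T} s * \<phi> s \<partial>lborel)"
    by (simp add: has_bochner_integral_integral_eq[OF f_t] mult.commute)
  finally have G: "(G has_integral B * (\<integral>s. indicator {0<..<T} s * \<phi> s \<partial>lborel)) UNIV" .
  \<comment> \<open>Two integrals of the same slice meet here, the Lebesgue one defining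
    \<open>G\<close> and the gauge one in \<open>conv\<close>. They agree where the slice is
    Lebesgue integrable, which Fubini grants for almost every t.\<close>
  have "AE t in lborel. G t = (if t \<in> {0<..<T} then (T - t) powr (- a) * h t else 0)"
    using lborel_pair.AE_integrable_snd[OF f_i]
  proof eventually_elim
    case (elim t)
    show ?case
    proof (cases "t \<in> {0<..<T}")
      case True
      have "((\<lambda>s. (T - t) powr (- a) * ((t - s) powr (a - 1) * \<phi> s)) has_integral (T - t) powr (- a) * h t) {0..t}"
        using True by (intro has_integral_mult_right conv) auto
      then have "((\<lambda>s. f s t) has_integral (T - t) powr (- a) * h t) {0..t}"
        by (rule has_integral_spike_finite[of "{0,t}", rotated 2]) (use True in \<open>auto simp: f_def k_def\<close>)
      then have "((\<lambda>s. f s t) has_integral (T - t) powr (- a) * h t) UNIV"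
        by (rule has_integral_on_superset) (use True in \<open>auto simp: f_def k_def\<close>)
      with has_integral_integral_real[OF elim] show ?thesis
        using True by (auto simp: G_def dest: has_integral_unique)
    next
      case False
      then have "f s t = 0" for s by (auto simp: f_def k_def)
      then have "G t = 0" by (simp add: G_def)
      then show ?thesis using False by (simp only: if_False)
    qed
  qed
  then have "AE t in lborel. t \<in> UNIV \<longrightarrow> G t = (if t \<in> {0<..<T} then (T - t) powr (- a) * h t else 0)"
    by simp
  from has_integral_AE[OF this] G
  have "((\<lambda>t. if t \<in> {0<..<T} then (T - t) powr (- a) * h t else 0) has_integral
      B * (\<integral>s. indicator {0<..<T} s * \<phi> s \<partial>lborel)) UNIV" by simp
  then have "((\<lambda>t. (T - t) powr (- a) * h t) has_integral
      B * (\<integral>s. indicator {0<..<T} s * \<phi> s \<partial>lborel)) {0<..<T}"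
    by (simp only: has_integral_restrict_UNIV)
  then show ?thesis unfolding B_def has_integral_Icc_iff_Ioo .
qed

text \<open>\<open>w\<close> is the fractional integral of \<phi> of order \<open>a\<close>, so a
  further one of order \<open>1 - a\<close> gives the plain integral of \<phi>. That is
  \<open>v T\<close> minus the limit of \<open>v\<close> at 0+, whose existence must be derived
  because nothing is assumed about \<open>v\<close> at 0.\<close>

lemma fractional_integral_of_derivative:
  fixes v \<phi> w N :: "real \<Rightarrow> real"
  assumes a: "0 < a" "a < 1" and T: "T > 0"
    and v: "\<And>t. t > 0 \<Longrightarrow> (v has_real_derivative \<phi> t) (at t)"
    and N: "N integrable_on {0..T}" "\<And>t. t > 0 \<Longrightarrow> \<bar>\<phi> t\<bar> \<le> N t"
    and conv: "\<And>t. t > 0 \<Longrightarrow> ((\<lambda>s. (t - s) powr (a - 1) * \<phi> s) has_integral Gamma a * w t) {0..t}"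
  obtains L where "(v \<longlongrightarrow> L) (at_right 0)"
    "((\<lambda>t. (T - t) powr (- a) * w t) has_integral Gamma (1 - a) * (v T - L)) {0..T}"
proof -
  define \<psi> where "\<psi> s = indicator {0<..} s * \<phi> s" for s
  have contv: "continuous_on {0<..} v"
    by (rule DERIV_continuous_on[where D = \<phi>]) (use v in \<open>auto intro: has_field_derivative_at_within\<close>)
  \<comment> \<open>A derivative is Borel measurable as a pointwise limit of difference quotients,
    each continuous on the open half-line.\<close>
  have \<psi>_m[measurable]: "\<psi> \<in> borel_measurable borel"
  proof (rule borel_measurable_LIMSEQ_real)
    let ?q = "\<lambda>i s. indicator {0<..} s *\<^sub>R ((v (s + 1 / real (Suc i)) - v s) / (1 / real (Suc i)))"
    show "?q i \<in> borel_measurable borel" for i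
    proof (rule borel_measurable_continuous_on_indicator)
      have "continuous_on {0<..} (\<lambda>s. v (s + 1 / real (Suc i)))"
        by (rule continuous_on_compose2[OF contv]) (auto intro!: continuous_intros add_pos_pos)
      then show "continuous_on {0<..} (\<lambda>s. (v (s + 1 / real (Suc i)) - v s) / (1 / real (Suc i)))"
        by (intro continuous_intros contv) auto
    qed simp
    fix s :: real
    show "(\<lambda>i. ?q i s) \<longlonglongrightarrow> \<psi> s"
    proof (cases "s > 0")
      case True
      have "filterlim (\<lambda>i. 1 / real (Suc i)) (at 0) sequentially"
        unfolding filterlim_at using LIMSEQ_Suc[OF lim_1_over_n] by auto
      with v[OF True] have "(\<lambda>i. (v (s + 1 / real (Suc i)) - v s) / (1 / real (Suc i))) \<longlonglongrightarrow> \<phi> s"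
        unfolding DERIV_def by (rule filterlim_compose)
      then show ?thesis using True by (simp add: \<psi>_def)
    qed (simp add: \<psi>_def)
  qed
  have "\<psi> absolutely_integrable_on {0..T}"
  proof (rule measurable_bounded_by_integrable_imp_absolutely_integrable)
    show "\<psi> \<in> borel_measurable (lebesgue_on {0..T})"
      by (rule borel_measurable_if_D, rule measurable_completion) simp
    show "(\<lambda>t. if t = 0 then 0 else N t) integrable_on {0..T}"
      by (rule integrable_spike_finite[OF _ _ N(1), of "{0}"]) auto
    show "norm (\<psi> t) \<le> (if t = 0 then 0 else N t)" if "t \<in> {0..T}" for t
      using that N(2)[of t] by (auto simp: \<psi>_def)
  qed simp
  then have i: "integrable lborel (\<lambda>s. indicator {0..T} s * \<psi> s)"
    unfolding set_integrable_def by (simp add: integrable_completion)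
  have ae: "AE s in lborel. indicator {0..T} s * \<psi> s = indicator {0<..<T} s * \<psi> s"
  proof -
    have "AE s in lborel. s \<noteq> 0 \<and> s \<noteq> T" using AE_lborel_singleton[of 0] AE_lborel_singleton[of T]
      by (auto intro: eventually_conj)
    then show ?thesis by eventually_elim (auto simp: indicator_def)
  qed
  have i': "integrable lborel (\<lambda>s. indicator {0<..<T} s * \<psi> s)"
    by (rule integrable_cong_AE_imp[OF i _ ae]) measurable
  have "((\<lambda>s. indicator {0..T} s * \<psi> s) has_integral (\<integral>s. indicator {0..T} s * \<psi> s \<partial>lborel)) UNIV"
    by (rule has_integral_integral_real[OF i])
  moreover have "(\<lambda>s. indicator {0..T} s * \<psi> s) = (\<lambda>s. if s \<in> {0..T} then \<psi> s else 0)"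
    by (auto simp: indicator_def)
  ultimately have I\<psi>: "(\<psi> has_integral (\<integral>s. indicator {0..T} s * \<psi> s \<partial>lborel)) {0..T}"
    by (simp only: has_integral_restrict_UNIV)
  \<comment> \<open>Continuity of the integral in its lower limit is what makes \<open>v\<close>
    converge at 0+.\<close>
  have "continuous_on {0..T} (\<lambda>\<epsilon>. integral {\<epsilon>..T} \<psi>)"
    by (rule indefinite_integral_continuous_1') (use I\<psi> in blast)
  then have "((\<lambda>\<epsilon>. integral {\<epsilon>..T} \<psi>) \<longlongrightarrow> integral {0..T} \<psi>) (at_right 0)"
    using T by (rule continuous_on_Icc_at_rightD)
  moreover have "\<forall>\<^sub>F \<epsilon> in at_right 0. integral {\<epsilon>..T} \<psi> = v T - v \<epsilon>"
    unfolding eventually_at_right_field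
  proof (intro exI[of _ T] conjI allI impI T)
    fix \<epsilon> assume \<epsilon>: "0 < \<epsilon>" "\<epsilon> < T"
    have "(\<psi> has_integral v T - v \<epsilon>) {\<epsilon>..T}"
    proof (rule fundamental_theorem_of_calculus)
      fix t assume "t \<in> {\<epsilon>..T}"
      then show "(v has_vector_derivative \<psi> t) (at t within {\<epsilon>..T})"
        using v[of t] \<epsilon> by (auto simp: \<psi>_def has_real_derivative_iff_has_vector_derivative
            intro: has_vector_derivative_at_within)
    qed (use \<epsilon> in simp)
    then show "integral {\<epsilon>..T} \<psi> = v T - v \<epsilon>" by (rule integral_unique)
  qed
  ultimately have lim: "((\<lambda>\<epsilon>. v T - v \<epsilon>) \<longlongrightarrow> integral {0..T} \<psi>) (at_right 0)"
    by (rule Lim_transform_eventually)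
  define L where "L = v T - integral {0..T} \<psi>"
  have "((\<lambda>\<epsilon>. v T - (v T - v \<epsilon>)) \<longlongrightarrow> L) (at_right 0)"
    unfolding L_def by (intro tendsto_diff tendsto_const lim)
  then have L: "(v \<longlongrightarrow> L) (at_right 0)" by simp
  have int: "(\<integral>s. indicator {0<..<T} s * \<psi> s \<partial>lborel) = v T - L"
    using integral_unique[OF I\<psi>] integral_cong_AE[OF _ _ ae] by (simp add: L_def)
  have "((\<lambda>t. (T - t) powr (- a) * (Gamma a * w t)) has_integral
    Gamma a * Gamma (1 - a) * (\<integral>s. indicator {0<..<T} s * \<psi> s \<partial>lborel)) {0..T}"
  proof (rule abel_inversion[OF a T \<psi>_m i'])
    fix t assume t: "0 < t" "t < T"
    show "((\<lambda>s. (t - s) powr (a - 1) * \<psi> s) has_integral Gamma a * w t) {0..t}"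
      by (rule has_integral_spike_finite[OF _ _ conv[OF t(1)], of "{0}"]) (auto simp: \<psi>_def)
  qed
  from has_integral_mult_right[OF this, of "1 / Gamma a"]
  have "((\<lambda>t. (T - t) powr (- a) * w t) has_integral Gamma (1 - a) * (v T - L)) {0..T}"
    using Gamma_real_pos[OF a(1)] unfolding int by (simp add: mult.assoc mult.left_commute[of _ "Gamma a"])
  with L show thesis by (rule that)
qed

lemma has_real_derivative_iterated_derivative_inner:
  fixes x :: "real \<Rightarrow> 'a::real_inner"
  assumes "iterated_derivative k x differentiable (at t)"
  shows "((\<lambda>t. iterated_derivative k x t \<bullet> v) has_real_derivative iterated_derivative (Suc k) x t \<bullet> v) (at t)"
proof -
  have "(iterated_derivative k x has_vector_derivative iterated_derivative (Suc k) x t) (at t)"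
    using vector_derivative_works[THEN iffD1, OF assms] by (simp add: iterated_derivative_def)
  from bounded_linear.has_vector_derivative[OF bounded_linear_inner_left this]
  show ?thesis by (simp add: has_real_derivative_iff_has_vector_derivative)
qed

text \<open>Fractional integration of order \<theta> + 1 - n, which lies in (0,1], recovers the
  derivative of order n - 1: the function itself for \<theta> \<le> 1 and its first derivative for
  \<theta> > 1. The initial data remove the boundary term.\<close>

lemma far_solution_volterra:
  fixes A :: "'a::{real_inner,banach} \<Rightarrow> 'b::real_inner"
  assumes sol: "far_solution \<theta> A y x" and \<theta>: "0 < \<theta>" "\<theta> < 2"
    and bl: "bounded_linear (adjoint A)" "bounded_linear A" and T: "T > 0"
  defines "n \<equiv> nat \<lceil>\<theta>\<rceil>"
  shows "((\<lambda>s. (T - s) powr (\<theta> - real n) * ((adjoint A y - adjoint A (A (x s))) \<bullet> v)) has_integral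
    Gamma (\<theta> + 1 - real n) * (iterated_derivative (n - 1) x T \<bullet> v)) {0..T}"
proof -
  define w where "w s = (adjoint A y - adjoint A (A (x s))) \<bullet> v" for s
  define X where "X k t = iterated_derivative k x t \<bullet> v" for k t
  have x0: "x 0 = 0" and cx: "continuous_on {0..} x"
    and "\<And>t. t > 0 \<Longrightarrow> caputo_derivative \<theta> x t + adjoint A (A (x t)) = adjoint A y"
    using sol by (auto simp: far_solution_def)
  then have eq: "caputo_derivative \<theta> x t \<bullet> v = w t" if "t > 0" for t
    using that by (metis add_diff_cancel w_def)
  have diff: "\<And>k t. k < n \<Longrightarrow> t > 0 \<Longrightarrow> iterated_derivative k x differentiable (at t)"
    and N: "\<And>t. t > 0 \<Longrightarrow> (\<lambda>s. norm (iterated_derivative n x s)) integrable_on {0..t}"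
    and int: "\<And>t. t > 0 \<Longrightarrow> \<theta> \<noteq> real n \<Longrightarrow>
      (\<lambda>s. (t - s) powr (real n - \<theta> - 1) *\<^sub>R iterated_derivative n x s) integrable_on {0..t}"
    using sol unfolding far_solution_def caputo_differentiable_def Let_def n_def by auto
  have deriv: "(X k has_real_derivative X (Suc k) t) (at t)" if "k < n" "t > 0" for k t
    using has_real_derivative_iterated_derivative_inner[OF diff[OF that]] unfolding X_def .
  have X0: "X 0 t = x t \<bullet> v" for t by (simp add: X_def iterated_derivative_def)
  have cX0: "continuous_on {0..} (X 0)" unfolding X0[abs_def] by (intro continuous_intros cx)
  have X00: "X 0 0 = 0" by (simp add: X0 x0)
  have lim0: "(X 0 \<longlongrightarrow> 0) (at_right 0)"
  proof -
    have "continuous (at 0 within {0..}) (X 0)"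
      using cX0 by (simp add: continuous_on_eq_continuous_within)
    then have "(X 0 \<longlongrightarrow> 0) (at 0 within {0..})" by (simp add: continuous_within X00)
    then show ?thesis by (rule tendsto_within_subset) auto
  qed
  have n: "n \<ge> 1" "real n - 1 < \<theta>" "\<theta> \<le> real n"
    using \<theta> unfolding n_def by linarith+
  have "((\<lambda>s. (T - s) powr (\<theta> - real n) * w s) has_integral Gamma (\<theta> + 1 - real n) * X (n - 1) T) {0..T}"
  proof (cases "\<theta> = real n")
    case True
    then have n1: "n = 1" "\<theta> = 1" using \<theta> n(1) by auto
    have w: "X 1 t = w t" if "t > 0" for t
      using eq[OF that] True n1 unfolding caputo_derivative_def Let_def n_def[symmetric] by (simp add: X_def)
    have "(w has_integral X 0 T - X 0 0) {0..T}"
    proof (rule fundamental_theorem_of_calculus_interior)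
      show "continuous_on {0..T} (X 0)" by (rule continuous_on_subset[OF cX0]) auto
      show "(X 0 has_vector_derivative w t) (at t)" if "t \<in> {0<..<T}" for t
        using deriv[of 0 t] that n1 w[of t] by (simp add: has_real_derivative_iff_has_vector_derivative)
    qed (use T in simp)
    then have "((\<lambda>s. (T - s) powr (\<theta> - real n) * w s) has_integral X 0 T - X 0 0) {0..T}"
      by (rule has_integral_spike_finite[of "{T}", rotated 2]) (auto simp: n1)
    then show ?thesis by (simp add: n1 X00)
  next
    case False
    define a where "a = real n - \<theta>"
    have a: "0 < a" "a < 1" using n False by (auto simp: a_def)
    have conv: "((\<lambda>s. (t - s) powr (a - 1) * X n s) has_integral Gamma a * w t) {0..t}" if t: "t > 0" for t
    proof -
      have "((\<lambda>s. (t - s) powr (a - 1) *\<^sub>R iterated_derivative n x s) has_integral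
          Gamma a *\<^sub>R caputo_derivative \<theta> x t) {0..t}"
        using integrable_integral[OF int[OF t False]] Gamma_real_pos[OF a(1)] False
        unfolding caputo_derivative_def Let_def n_def[symmetric] a_def[symmetric] by simp
      from has_integral_linear[OF this bounded_linear_inner_left[of v]] show ?thesis
        by (simp add: o_def X_def eq[OF t])
    qed
    obtain l where l: "(X (n - 1) \<longlongrightarrow> l) (at_right 0)"
      "((\<lambda>t. (T - t) powr (- a) * w t) has_integral Gamma (1 - a) * (X (n - 1) T - l)) {0..T}"
    proof (rule fractional_integral_of_derivative[OF a T _ _ _ conv])
      show "(X (n - 1) has_real_derivative X n t) (at t)" if "t > 0" for t
        using deriv[of "n - 1" t] n(1) that by simp
      show "(\<lambda>s. norm (iterated_derivative n x s) * norm v) integrable_on {0..T}"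
        by (intro integrable_on_mult_left N T)
      show "\<bar>X n t\<bar> \<le> norm (iterated_derivative n x t) * norm v" for t
        unfolding X_def by (rule Cauchy_Schwarz_ineq2)
    qed
    \<comment> \<open>For n = 1 this limit is the initial value. For n = 2 L'Hospital's rule equates
      it with the limit of \<open>X 0 t / t\<close>, the right derivative prescribed at 0.\<close>
    have "l = 0"
    proof (cases "\<theta> \<le> 1")
      case True
      then have "n = 1" using n by linarith
      then show ?thesis using lim0 l(1) by (intro tendsto_unique[where F = "at_right (0::real)"]) auto
    next
      case False
      then have n2: "n = 2" using n \<theta> by linarith
      have "((\<lambda>t. X 0 t / t) \<longlongrightarrow> l) (at_right 0)"
      proof (rule lhopital_right_0[OF lim0])
        show "\<forall>\<^sub>F t in at_right 0. (X 0 has_real_derivative X 1 t) (at t)"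
          using deriv[of 0] n2 by (auto simp: eventually_at_right_field intro: exI[of _ 1])
        show "((\<lambda>t. X 1 t / 1) \<longlongrightarrow> l) (at_right 0)" using l n2 by simp
      qed (auto simp: eventually_at_right_field intro!: exI[of _ 1] tendsto_intros)
      moreover have "((\<lambda>t. X 0 t / t) \<longlongrightarrow> 0) (at_right 0)"
      proof -
        have "(x has_vector_derivative 0) (at 0 within {0..})" using sol False by (simp add: far_solution_def)
        from bounded_linear.has_vector_derivative[OF bounded_linear_inner_left this, of v]
        have "(X 0 has_real_derivative 0) (at 0 within {0..})"
          unfolding X0[abs_def] by (simp add: has_real_derivative_iff_has_vector_derivative)
        then have "((\<lambda>t. X 0 t / t) \<longlongrightarrow> 0) (at 0 within {0..})"
          by (simp add: has_field_derivative_iff X00)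
        then show ?thesis by (rule tendsto_within_subset) auto
      qed
      ultimately show ?thesis by (intro tendsto_unique[where F = "at_right (0::real)"]) auto
    qed
    with l(2) have "((\<lambda>t. (T - t) powr (- a) * w t) has_integral Gamma (1 - a) * X (n - 1) T) {0..T}" by simp
    then show ?thesis by (simp add: a_def algebra_simps)
  qed
  then show ?thesis unfolding w_def X_def .
qed

subsection \<open>Uniqueness and existence of solutions\<close>

text \<open>The zero set propagates by steps of a fixed length on which the estimate is a contraction.\<close>

lemma zero_if_volterra_bound:
  fixes z :: "real \<Rightarrow> 'a::real_normed_vector"
  assumes \<theta>: "\<theta> > 0" and K: "K \<ge> 0" and cont: "continuous_on {0..} z" and z0: "z 0 = 0"
    and bound: "\<And>\<tau> t m. 0 \<le> \<tau> \<Longrightarrow> \<tau> < t \<Longrightarrow> (\<And>s. 0 \<le> s \<Longrightarrow> s \<le> \<tau> \<Longrightarrow> z s = 0) \<Longrightarrow>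
      (\<And>s. 0 \<le> s \<Longrightarrow> s \<le> t \<Longrightarrow> norm (z s) \<le> m) \<Longrightarrow> norm (z t) \<le> K * m * (t - \<tau>) powr \<theta>"
    and t: "t \<ge> 0"
  shows "z t = 0"
proof -
  \<comment> \<open>Chosen so that \<open>K * \<delta> powr \<theta>\<close> is K / (2 (K + 1)),
    hence at most 1/2; the 1 added to K covers K = 0.\<close>
  define \<delta> where "\<delta> = (1 / (2 * (K + 1))) powr (1 / \<theta>)"
  have \<delta>: "\<delta> > 0" "\<delta> powr \<theta> = 1 / (2 * (K + 1))" using \<theta> K by (auto simp: \<delta>_def powr_powr)
  have half: "K * \<delta> powr \<theta> \<le> 1 / 2" unfolding \<delta>(2) using K by (simp add: field_simps)
  have zero: "\<forall>s. 0 \<le> s \<and> s \<le> real j * \<delta> \<longrightarrow> z s = 0" for j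
  proof (induction j)
    case 0
    then show ?case using z0 by auto
  next
    case (Suc j)
    let ?\<tau> = "real j * \<delta>" and ?t = "real (Suc j) * \<delta>"
    have "continuous_on {0..?t} (\<lambda>s. norm (z s))"
      by (intro continuous_intros continuous_on_subset[OF cont]) auto
    moreover have "{0..?t} \<noteq> {}" using \<delta> by (simp add: zero_le_mult_iff)
    \<comment> \<open>At a maximum point \<open>p\<close> of the norm the bound reads norm (z p)
      \<le> norm (z p) / 2, so \<open>z\<close> vanishes on the next step as well.\<close>
    ultimately obtain p where p: "p \<in> {0..?t}" "\<And>s. s \<in> {0..?t} \<Longrightarrow> norm (z s) \<le> norm (z p)"
      using continuous_attains_sup[of "{0..?t}" "\<lambda>s. norm (z s)"] by auto
    have "norm (z p) \<le> 0"
    proof (cases "p \<le> ?\<tau>")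
      case True
      then show ?thesis using Suc p(1) by auto
    next
      case False
      have "norm (z p) \<le> K * norm (z p) * (p - ?\<tau>) powr \<theta>"
        by (rule bound) (use Suc False p \<delta> in auto)
      also have "\<dots> \<le> K * norm (z p) * \<delta> powr \<theta>"
        using False p(1) \<delta>(1) \<theta> K by (intro mult_left_mono powr_mono2) (auto simp: algebra_simps)
      also have "\<dots> = (K * \<delta> powr \<theta>) * norm (z p)" by simp
      also have "\<dots> \<le> 1 / 2 * norm (z p)" by (rule mult_right_mono[OF half]) simp
      finally show ?thesis by simp
    qed
    then show ?case using p(2) by fastforce
  qed
  obtain j :: nat where "t < real j * \<delta>" using reals_Archimedean3[OF \<delta>(1)] by blast
  then show ?thesis using zero[of j] t by auto
qed

text \<open>The difference of two solutions satisfies a homogeneous Volterra equation, but for its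
  derivative of order n - 1. For \<theta> > 1 the mean value theorem carries the bound back to the
  function, and its factor t - \<tau> raises the exponent from \<theta> - 1 to \<theta>.\<close>

lemma far_solution_unique:
  fixes A :: "'a::{real_inner,banach} \<Rightarrow> 'b::real_inner"
  assumes sol: "far_solution \<theta> A y x1" "far_solution \<theta> A y x2" and \<theta>: "0 < \<theta>" "\<theta> < 2"
    and bl: "bounded_linear (adjoint A)" "bounded_linear A" and t: "t \<ge> 0"
  shows "x1 t = x2 t"
proof -
  define n where "n = nat \<lceil>\<theta>\<rceil>"
  define \<beta> where "\<beta> = \<theta> + 1 - real n"
  have n: "n \<ge> 1" "real n - 1 < \<theta>" "\<theta> \<le> real n"
    using \<theta> unfolding n_def by linarith+
  have \<beta>: "\<beta> > 0" using n by (simp add: \<beta>_def)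
  define T where "T u = adjoint A (A u)" for u
  have blT: "bounded_linear T" unfolding T_def by (rule bounded_linear_compose[OF bl])
  define M where "M = onorm T"
  have M: "M \<ge> 0" "norm (T u) \<le> M * norm u" for u
    unfolding M_def using onorm_pos_le[OF blT] onorm[OF blT] by auto
  define z where "z s = x1 s - x2 s" for s
  define Z where "Z k s v = (iterated_derivative k x1 s - iterated_derivative k x2 s) \<bullet> v" for k s v
  have Z0: "Z 0 s v = z s \<bullet> v" for s v by (simp add: Z_def z_def iterated_derivative_def)
  have deriv: "((\<lambda>s. Z k s v) has_real_derivative Z (Suc k) s v) (at s)" if "k < n" "s > 0" for k s v
  proof -
    have "iterated_derivative k x1 differentiable (at s)" "iterated_derivative k x2 differentiable (at s)"
      using sol that unfolding far_solution_def caputo_differentiable_def Let_def n_def by auto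
    from DERIV_diff[OF this[THEN has_real_derivative_iterated_derivative_inner, of v]]
    show ?thesis by (simp add: Z_def inner_diff_left)
  qed
  have cz: "continuous_on {0..} z" unfolding z_def
    using sol by (auto simp: far_solution_def intro!: continuous_intros)
  have volterra: "((\<lambda>s. (t - s) powr (\<beta> - 1) * (- T (z s) \<bullet> v)) has_integral Gamma \<beta> * Z (n - 1) t v) {0..t}"
    if "t > 0" for t v
    using has_integral_diff[OF far_solution_volterra[OF sol(1) \<theta> bl that, of v] far_solution_volterra[OF sol(2) \<theta> bl that, of v]]
    by (simp add: n_def[symmetric] \<beta>_def Z_def z_def T_def[symmetric] bounded_linear.linear[OF blT, THEN linear_diff]
        algebra_simps inner_diff_left)
  \<comment> \<open>\<open>M\<close> bounds the operator, \<open>Beta \<beta> 1\<close> comes from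
    integrating \<open>(t - s) powr (\<beta> - 1)\<close> over \<open>{\<tau>..t}\<close>, and
    \<open>Gamma \<beta>\<close> from the Volterra equation.\<close>
  define K where "K = M * Beta \<beta> 1 / Gamma \<beta>"
  have B: "Beta \<beta> 1 > 0" "Gamma \<beta> > 0" using \<beta> by (auto simp: Beta_def)
  have K: "K \<ge> 0" using M B by (simp add: K_def)
  have bound1: "\<bar>Z (n - 1) t v\<bar> \<le> K * m * (t - \<tau>) powr \<beta> * norm v"
    if \<tau>: "0 \<le> \<tau>" "\<tau> < t" and z0: "\<And>s. 0 \<le> s \<Longrightarrow> s \<le> \<tau> \<Longrightarrow> z s = 0"
      and m: "\<And>s. 0 \<le> s \<Longrightarrow> s \<le> t \<Longrightarrow> norm (z s) \<le> m" for \<tau> t m v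
  proof -
    let ?f = "\<lambda>s. (t - s) powr (\<beta> - 1) * (- T (z s) \<bullet> v)"
    \<comment> \<open>The factor \<open>(s - \<tau>) powr (1 - 1)\<close> brings the majorant into
      Beta-kernel form. It is 0 at s = \<tau>, where the integrand also vanishes because
      \<open>z \<tau> = 0\<close>.\<close>
    let ?g = "\<lambda>s. (t - s) powr (\<beta> - 1) * (s - \<tau>) powr (1 - 1) * (M * m * norm v)"
    have "((\<lambda>s. if s \<in> {\<tau>..t} then ?f s else 0) has_integral Gamma \<beta> * Z (n - 1) t v) {0..t}"
      using \<tau> z0 by (intro has_integral_eq[OF _ volterra])
        (auto simp: bounded_linear.linear[OF blT, THEN linear_0])
    then have f: "(?f has_integral Gamma \<beta> * Z (n - 1) t v) {\<tau>..t}"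
      using \<tau> by (subst (asm) has_integral_restrict) auto
    have g: "(?g has_integral (t - \<tau>) powr \<beta> * Beta \<beta> 1 * (M * m * norm v)) {\<tau>..t}"
      using has_integral_mult_left[OF has_integral_beta_kernel[OF \<beta> zero_less_one \<tau>(2)]] by simp
    have "norm (?f s) \<le> ?g s" if s: "s \<in> {\<tau>..t}" for s
    proof (cases "s = \<tau>")
      case True
      then show ?thesis using z0[of \<tau>] \<tau> by (simp add: bounded_linear.linear[OF blT, THEN linear_0])
    next
      case False
      have "\<bar>T (z s) \<bullet> v\<bar> \<le> norm (T (z s)) * norm v" by (rule Cauchy_Schwarz_ineq2)
      also have "\<dots> \<le> M * m * norm v"
        using s \<tau> by (intro mult_right_mono order_trans[OF M(2)] mult_left_mono m M(1)) auto
      finally show ?thesis using False s by (simp add: abs_mult mult_left_mono)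
    qed
    then have "norm (integral {\<tau>..t} ?f) \<le> integral {\<tau>..t} ?g"
      using f g by (intro integral_norm_bound_integral) auto
    then have "Gamma \<beta> * \<bar>Z (n - 1) t v\<bar> \<le> (t - \<tau>) powr \<beta> * Beta \<beta> 1 * (M * m * norm v)"
      unfolding integral_unique[OF f] integral_unique[OF g] using B by (simp add: abs_mult)
    then show ?thesis using B by (simp add: K_def field_simps)
  qed
  have "z t = 0"
  proof (rule zero_if_volterra_bound[OF \<theta>(1) K cz])
    fix \<tau> t m :: real
    assume \<tau>: "0 \<le> \<tau>" "\<tau> < t" and z0: "\<And>s. 0 \<le> s \<Longrightarrow> s \<le> \<tau> \<Longrightarrow> z s = 0"
      and m: "\<And>s. 0 \<le> s \<Longrightarrow> s \<le> t \<Longrightarrow> norm (z s) \<le> m"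
    have m0: "m \<ge> 0" using m[of 0] \<tau> norm_ge_zero[of "z 0"] by linarith
    have "\<bar>z t \<bullet> v\<bar> \<le> K * m * (t - \<tau>) powr \<theta> * norm v" for v
    proof (cases "n = 1")
      case True
      then show ?thesis using bound1[OF \<tau> z0 m, of v] by (simp add: Z0 \<beta>_def)
    next
      case False
      then have n2: "n = 2" using n \<theta> by linarith
      have "\<exists>l \<xi>. \<tau> < \<xi> \<and> \<xi> < t \<and> DERIV (\<lambda>s. Z 0 s v) \<xi> :> l \<and> Z 0 t v - Z 0 \<tau> v = (t - \<tau>) * l"
      proof (rule MVT[OF \<tau>(2)])
        show "continuous_on {\<tau>..t} (\<lambda>s. Z 0 s v)" unfolding Z0
          by (intro continuous_intros continuous_on_subset[OF cz]) (use \<tau> in auto)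
        show "(\<lambda>s. Z 0 s v) differentiable (at s)" if "\<tau> < s" for s
          using deriv[of 0 s v] that \<tau> n2 real_differentiable_def by auto
      qed
      then obtain l \<xi> where \<xi>: "\<tau> < \<xi>" "\<xi> < t" "DERIV (\<lambda>s. Z 0 s v) \<xi> :> l"
        "Z 0 t v - Z 0 \<tau> v = (t - \<tau>) * l" by blast
      have "l = Z 1 \<xi> v" using deriv[of 0 \<xi> v] \<xi> \<tau> n2 by (intro DERIV_unique[OF \<xi>(3)]) auto
      then have "\<bar>z t \<bullet> v\<bar> = (t - \<tau>) * \<bar>Z 1 \<xi> v\<bar>"
        using \<xi>(4) z0[of \<tau>] \<tau> by (simp add: Z0 abs_mult)
      also have "\<dots> \<le> (t - \<tau>) * (K * m * (\<xi> - \<tau>) powr \<beta> * norm v)"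
        using bound1[OF \<tau>(1) \<xi>(1) z0, of m v] m \<xi>(2) \<tau> n2 by (intro mult_left_mono) auto
      also have "\<dots> \<le> (t - \<tau>) * (K * m * (t - \<tau>) powr \<beta> * norm v)"
        using \<xi> \<tau> \<beta> K m0 by (intro mult_left_mono mult_right_mono powr_mono2) auto
      also have "\<dots> = K * m * ((t - \<tau>) * (t - \<tau>) powr \<beta>) * norm v" by simp
      also have "(t - \<tau>) * (t - \<tau>) powr \<beta> = (t - \<tau>) powr \<theta>"
        using \<tau> n2 powr_mult_base[of "t - \<tau>" \<beta>] by (simp add: \<beta>_def algebra_simps)
      finally show ?thesis .
    qed
    \<comment> \<open>Testing with \<open>v = z t\<close> turns the weak bounds into a norm
      bound.\<close>
    from this[of "z t"] have "norm (z t) * norm (z t) \<le> K * m * (t - \<tau>) powr \<theta> * norm (z t)"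
      by (simp add: power2_norm_eq_inner[symmetric] power2_eq_square)
    then show "norm (z t) \<le> K * m * (t - \<tau>) powr \<theta>"
      using K m0 by (cases "z t = 0") auto
  qed (use sol t in \<open>auto simp: z_def far_solution_def\<close>)
  then show ?thesis by (simp add: z_def)
qed

text \<open>In the family \<open>G c\<close> differentiation lowers \<open>c\<close> by 1 and
  fractional integration of order \<open>a\<close> raises it by \<open>a\<close>. From \<theta> + 1,
  n derivatives and an integration of order n - \<theta> lead to index 1, where the recurrence
  closes the equation.\<close>

lemma far_solution_mittag_leffler_op:
  fixes A :: "'a::{real_inner,banach} \<Rightarrow> 'b::real_inner"
  assumes \<theta>: "0 < \<theta>" "\<theta> < 2" and bl: "bounded_linear (adjoint A)" "bounded_linear A"
  defines "T \<equiv> adjoint A \<circ> A"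
  shows "far_solution \<theta> A y (\<lambda>t. t powr \<theta> *\<^sub>R mittag_leffler_op \<theta> (\<theta> + 1) T (adjoint A y) (t powr \<theta>))"
proof -
  define b where "b = adjoint A y"
  define x where "x t = t powr \<theta> *\<^sub>R mittag_leffler_op \<theta> (\<theta> + 1) T b (t powr \<theta>)" for t
  define G where "G c t = t powr (c - 1) *\<^sub>R mittag_leffler_op \<theta> c T b (t powr \<theta>)" for c t
  have blT: "bounded_linear T" unfolding T_def o_def by (rule bounded_linear_compose[OF bl])
  define n where "n = nat \<lceil>\<theta>\<rceil>"
  define \<beta> where "\<beta> = \<theta> + 1 - real n"
  have n: "n \<ge> 1" "real n - 1 < \<theta>" "\<theta> \<le> real n"
    using \<theta> unfolding n_def by linarith+
  have \<beta>: "\<beta> > 0" using n by (simp add: \<beta>_def)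
  have cont_powr: "continuous_on {0..} (\<lambda>s. s powr c)" if "c > 0" for c :: real
    using that by (intro continuous_on_powr' continuous_intros) auto
  have cont_ml: "continuous_on {0..} (\<lambda>s. mittag_leffler_op \<theta> c T b (s powr \<theta>))" if "c > 0" for c
    by (intro continuous_on_mittag_leffler_op[OF \<theta>(1) blT that] cont_powr \<theta>)
  have step: "(iterated_derivative k x has_vector_derivative G (\<theta> + 1 - real (Suc k)) t) (at t)"
    if eq: "\<And>t. t > 0 \<Longrightarrow> iterated_derivative k x t = G (\<theta> + 1 - real k) t" and k: "k < n" and t: "t > 0" for k t
  proof (rule has_vector_derivative_transform_within_open[of _ _ _ "{0<..}"])
    have "\<theta> - real k > 0" using k n by linarith
    from has_vector_derivative_mittag_leffler_op[OF \<theta>(1) blT this t, of b]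
    show "(G (\<theta> + 1 - real k) has_vector_derivative G (\<theta> + 1 - real (Suc k)) t) (at t)"
      by (simp add: G_def[abs_def] algebra_simps)
  qed (use eq t in auto)
  have iter: "iterated_derivative k x t = G (\<theta> + 1 - real k) t" if "k \<le> n" "t > 0" for k t
    using that
  proof (induction k arbitrary: t)
    case 0
    then show ?case by (simp add: iterated_derivative_def x_def G_def)
  next
    case (Suc k)
    have "(iterated_derivative k x has_vector_derivative G (\<theta> + 1 - real (Suc k)) t) (at t)"
      by (rule step) (use Suc in auto)
    from vector_derivative_at[OF this] show ?case by (simp add: iterated_derivative_def)
  qed
  have frac: "((\<lambda>s. (t - s) powr (real n - \<theta> - 1) *\<^sub>R iterated_derivative n x s) has_integral
      Gamma (real n - \<theta>) *\<^sub>R mittag_leffler_op \<theta> 1 T b (t powr \<theta>)) {0..t}"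
    if "\<theta> \<noteq> real n" "t > 0" for t
  \<comment> \<open>The formula \<open>iter\<close> covers positive times only, so the point 0 is
    discarded as negligible.\<close>
  proof (rule has_integral_spike_finite[of "{0}"])
    have "real n - \<theta> > 0" using n that by simp
    from fractional_integral_mittag_leffler_op[OF \<theta>(1) blT this \<beta> that(2), of b]
    show "((\<lambda>s. (t - s) powr (real n - \<theta> - 1) *\<^sub>R G \<beta> s) has_integral
      Gamma (real n - \<theta>) *\<^sub>R mittag_leffler_op \<theta> 1 T b (t powr \<theta>)) {0..t}"
      using that(2) by (simp add: G_def \<beta>_def)
  qed (use iter[of n] in \<open>auto simp: \<beta>_def\<close>)
  have "caputo_differentiable \<theta> x"
    unfolding caputo_differentiable_def Let_def n_def[symmetric]
  proof (intro conjI allI impI)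
    show "iterated_derivative k x differentiable (at t)" if "k < n" "0 < t" for k t
      by (rule differentiableI_vector, rule step) (use iter that in auto)
    fix t :: real assume t: "t > 0"
    show "(\<lambda>s. (t - s) powr (real n - \<theta> - 1) *\<^sub>R iterated_derivative n x s) integrable_on {0..t}"
      if "\<theta> \<noteq> real n" using frac[OF that t] by blast
    \<comment> \<open>The Beta kernel with first order 1 shows that the singularity
      \<open>s powr (\<beta> - 1)\<close> is integrable; the Mittag-Leffler factor is continuous,
      hence bounded, on \<open>{0..t}\<close>.\<close>
    have "((\<lambda>s. (t - s) powr (1 - 1) * (s - 0) powr (\<beta> - 1)) has_integral (t - 0) powr (1 + \<beta> - 1) * Beta 1 \<beta>) {0..t}"
      by (rule has_integral_beta_kernel[OF zero_less_one \<beta> t])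
    then have "((\<lambda>s. s powr (\<beta> - 1)) has_integral (t - 0) powr (1 + \<beta> - 1) * Beta 1 \<beta>) {0..t}"
      by (rule has_integral_spike_finite[of "{t}", rotated 2]) auto
    then have p: "(\<lambda>s. s powr (\<beta> - 1)) absolutely_integrable_on {0..t}"
      by (intro nonnegative_absolutely_integrable_1) auto
    have c: "continuous_on {0..t} (\<lambda>s. norm (mittag_leffler_op \<theta> \<beta> T b (s powr \<theta>)))"
      by (intro continuous_on_norm continuous_on_subset[OF cont_ml[OF \<beta>]]) auto
    have "(\<lambda>s. norm (mittag_leffler_op \<theta> \<beta> T b (s powr \<theta>)) * s powr (\<beta> - 1)) absolutely_integrable_on {0..t}"
      by (rule absolutely_integrable_bounded_measurable_product_real[OF _ _ _ p])
        (auto intro!: continuous_imp_measurable_on_sets_lebesgue c compact_imp_bounded compact_continuous_image)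
    then have "(\<lambda>s. norm (mittag_leffler_op \<theta> \<beta> T b (s powr \<theta>)) * s powr (\<beta> - 1)) integrable_on {0..t}"
      by (rule set_lebesgue_integral_eq_integral(1))
    then show "(\<lambda>s. norm (iterated_derivative n x s)) integrable_on {0..t}"
      by (rule integrable_spike_finite[of "{0}", rotated 2]) (auto simp: iter G_def \<beta>_def[symmetric])
  qed
  moreover have "caputo_derivative \<theta> x t + adjoint A (A (x t)) = b" if t: "t > 0" for t
  proof -
    have "caputo_derivative \<theta> x t = mittag_leffler_op \<theta> 1 T b (t powr \<theta>)"
    proof (cases "\<theta> = real n")
      case True
      then have "n = 1" "\<theta> = 1" using \<theta> n by auto
      then show ?thesis using iter[of 1 t] t
        unfolding caputo_derivative_def Let_def n_def[symmetric] by (simp add: G_def)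
    next
      case False
      then have "Gamma (real n - \<theta>) > 0" using n by (intro Gamma_real_pos) auto
      then show ?thesis using integral_unique[OF frac[OF False t]] False
        unfolding caputo_derivative_def Let_def n_def[symmetric] by simp
    qed
    also have "\<dots> = b - T (x t)"
      using mittag_leffler_op_recurrence[OF \<theta>(1) blT zero_less_one, of b "t powr \<theta>"]
      by (simp add: x_def linear_scale[OF bounded_linear.linear[OF blT]])
    finally show ?thesis by (simp add: T_def)
  qed
  moreover have "continuous_on {0..} x" unfolding x_def
    by (intro continuous_on_scaleR cont_powr cont_ml) (use \<theta> in auto)
  moreover have x0: "x 0 = 0" by (simp add: x_def)
  moreover have "(x has_vector_derivative 0) (at 0 within {0..})" if "\<theta> > 1"
  proof -
    \<comment> \<open>For positive s this is the difference quotient x(s)/s. It tends to 0 because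
      \<theta> - 1 > 0, which gives the right derivative.\<close>
    let ?h = "\<lambda>s. s powr (\<theta> - 1) *\<^sub>R mittag_leffler_op \<theta> (\<theta> + 1) T b (s powr \<theta>)"
    have "continuous_on {0..} ?h"
      by (intro continuous_on_scaleR cont_powr cont_ml) (use \<theta> that in auto)
    then have "(?h \<longlongrightarrow> ?h 0) (at 0 within {0..})" unfolding continuous_on_def by (rule bspec) simp
    then have "(?h \<longlongrightarrow> 0) (at 0 within {0..})" by simp
    moreover have "\<forall>\<^sub>F s in at 0 within {0..}. ?h s = (1 / norm (s - 0)) *\<^sub>R (x s - (x 0 + (s - 0) *\<^sub>R 0))"
      unfolding eventually_at_filter
      by (intro always_eventually) (auto simp: x_def powr_diff divide_inverse mult.commute)
    ultimately show ?thesis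
      unfolding has_vector_derivative_def has_derivative_within
      by (auto intro: Lim_transform_eventually simp: bounded_linear_zero)
  qed
  ultimately have "far_solution \<theta> A y x" unfolding far_solution_def b_def by auto
  then show ?thesis unfolding x_def b_def .
qed

section \<open>Identification with the spectral calculus\<close>

lemma operator_function_far_generator:
  fixes A :: "'a::{real_inner,banach} \<Rightarrow> 'b::{real_inner,banach}"
  assumes A: "compact_operator A" and \<theta>: "0 < \<theta>"
  defines "T \<equiv> adjoint A \<circ> A"
  shows "operator_function T (far_time_generator \<theta> t) b = t powr \<theta> *\<^sub>R mittag_leffler_op \<theta> (\<theta> + 1) T b (t powr \<theta>)"
proof -
  have bl: "bounded_linear A" using A by (simp add: compact_operator_def)
  have blT: "bounded_linear T" unfolding T_def o_def
    by (rule bounded_linear_compose[OF bounded_linear_hilbert_adjoint[OF bl] bl])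
  let ?S = "\<lambda>b. t powr \<theta> *\<^sub>R mittag_leffler_op \<theta> (\<theta> + 1) T b (t powr \<theta>)"
  have c: "\<theta> + 1 > 0" using \<theta> by simp
  have "bounded_linear ?S"
    by (rule bounded_linear_compose[OF bounded_linear_scaleR_right bounded_linear_mittag_leffler_op[OF \<theta> blT c]])
  from has_sum_bounded_linear[OF this has_sum_eigenspace_projections[OF A, folded T_def]]
  have "((\<lambda>\<mu>. ?S (orthogonal_projection (eigenspace T \<mu>) b)) has_sum ?S b) (eigenvalues T)" .
  moreover have "?S (orthogonal_projection (eigenspace T \<mu>) b)
      = far_time_generator \<theta> t \<mu> *\<^sub>R orthogonal_projection (eigenspace T \<mu>) b" for \<mu>
  proof -
    have "T (orthogonal_projection (eigenspace T \<mu>) b) = \<mu> *\<^sub>R orthogonal_projection (eigenspace T \<mu>) b"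
      using orthogonal_projection_works(1)[OF closed_eigenspace[OF blT]] by (simp add: eigenspace_def)
    from mittag_leffler_op_eigenvector[OF \<theta> blT c this] show ?thesis
      by (simp add: far_time_generator_def)
  qed
  ultimately show ?thesis unfolding operator_function_def by (simp add: infsumI)
qed

theorem theorem3p1:
  fixes A :: "'x::{real_inner,banach} \<Rightarrow> 'y::{real_inner,banach}"
    and \<theta> C :: real
  assumes "infinite_dimensional (UNIV :: 'x set)"
    and "infinite_dimensional (UNIV :: 'y set)"
    and "compact_operator A"
    and "infinite_dimensional (range A)"
    and "0 < \<theta>" and "\<theta> < 2"
    and "C > 0"
    and "\<And>z. z \<ge> 0 \<Longrightarrow> \<bar>mittag_leffler \<theta> (\<theta> + 1) (- z)\<bar> \<le> C / (1 + z)"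
    and "\<And>z. z \<ge> 0 \<Longrightarrow> \<bar>mittag_leffler \<theta> 1 (- z)\<bar> \<le> C / (1 + z)"
  shows "(\<forall>\<alpha>>0. \<forall>\<mu>\<in>{0<..(onorm A)\<^sup>2}.
            far_generator \<theta> \<alpha> \<mu> = inverse \<alpha> * mittag_leffler \<theta> (\<theta> + 1) (- \<mu> * inverse \<alpha>)) \<and>
         (\<forall>\<alpha>bar>0. generator_function A \<alpha>bar (far_generator \<theta>) \<and>
                   generator_bound A \<alpha>bar (far_generator \<theta>) (C / 2)) \<and>
         (\<forall>y\<delta>. \<exists>x. far_solution \<theta> A y\<delta> x) \<and>
         (\<forall>x. (\<forall>y\<delta>. far_solution \<theta> A y\<delta> (x y\<delta>)) \<longrightarrow>
            (\<forall>\<alpha>bar>0. linear_regularization_method A \<alpha>bar (far_generator \<theta>)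
                        (\<lambda>\<alpha> y\<delta>. x y\<delta> (\<alpha> powr (- 1 / \<theta>)))))"
proof -
  note A = assms(3) and \<theta> = assms(5,6)
  have bl: "bounded_linear A" using A by (simp add: compact_operator_def)
  note bl' = bounded_linear_hilbert_adjoint[OF bl]
  note sol = far_solution_mittag_leffler_op[OF \<theta> bl' bl]
  note gen = generator_function_far[OF \<theta>(1) assms(7,8,9), of A]
  have "linear_regularization_method A \<alpha>bar (far_generator \<theta>) (\<lambda>\<alpha> y\<delta>. x y\<delta> (\<alpha> powr (- 1 / \<theta>)))"
    if x: "\<And>y\<delta>. far_solution \<theta> A y\<delta> (x y\<delta>)" for x \<alpha>bar
    unfolding linear_regularization_method_def
  proof (intro conjI ballI allI gen(2))
    fix \<alpha> y
    define t where "t = \<alpha> powr (- 1 / \<theta>)"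
    have "x y t = operator_function (adjoint A \<circ> A) (far_time_generator \<theta> t) (adjoint A y)"
      unfolding operator_function_far_generator[OF A \<theta>(1)]
      by (rule far_solution_unique[OF x sol \<theta> bl' bl]) (simp add: t_def)
    then show "x y (\<alpha> powr (- 1 / \<theta>)) = operator_function (adjoint A \<circ> A) (far_generator \<theta> \<alpha>) (adjoint A y)"
      by (simp add: t_def far_generator_def[abs_def])
  qed
  with gen sol far_generator_eq[OF \<theta>(1)] show ?thesis by blast
qed

end
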